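(* Let $A$ be an abelian group, let $G$ and $H$ be finite groups and let $(U,\phi)\in\mathcal{M}_{G\times H}$. Set $P=p_1(U)$, $K=k_1(U)$, $\kappa=\phi_1$, $Q=p_2(U)$, $L=k_2(U)$, $\lambda=\phi_2$, $\hat K=\ker(\kappa)$ and $\hat L=\ker(\lambda)$. Then one has the decomposition (isomorphism of $A$-fibered $(G,H)$-bisets) $$\left(\frac{G\times H}{U,\phi}\right)\cong\mathrm{Ind}_P^G\otimes_{AP}\mathrm{Inf}_{P/\hat K}^P\otimes_{A(P/\hat K)}X\otimes_{A(Q/\hat L)}\mathrm{Def}^Q_{Q/\hat L}\otimes_{AQ}\mathrm{Res}^H_Q,$$ where $$X=\left(\frac{P/\hat K\times Q/\hat L}{U/(\hat K\times\hat L),\ \bar\phi}\right).$$ Here $\bar\phi\colon U/(\hat K\times\hat L)\to A$ is induced by $\phi$, and $U/(\hat K\times\hat L)$ is viewed as a subgroup of $(P/\hat K)\times(Q/\hat L)$ via the canonical isomorphism $(P\times Q)/(\hat K\times\hat L)\cong(P/\hat K)\times(Q/\hat L)$.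
   Context: $A$ is written multiplicatively. For a finite group $U$, $U^*=\mathrm{Hom}(U,A)$; $\mathcal{M}_G$ is the set of pairs $(K,\kappa)$ with $K\le G$ and $\kappa\in K^*$. For $(U,\phi)\in\mathcal{M}_{G\times H}$: $p_1(U)\le G$, $p_2(U)\le H$ are the projections, $k_1(U)=\{g\in G:(g,1)\in U\}$, $k_2(U)=\{h\in H:(1,h)\in U\}$, and $\phi_i\in k_i(U)^*$ are defined by $\phi(g,h)=\phi_1(g)\phi_2(h)^{-1}$ for $(g,h)\in k_1(U)\times k_2(U)$. (The subgroups $\hat K\trianglelefteq P$ and $\hat L\trianglelefteq Q$ are normal.) An $A$-fibered $(G,H)$-biset is a left $A\times G\times H$-set which is free as an $A$-set and has finitely many $A$-orbits. $\left(\frac{G\times H}{U,\phi}\right)=(A\times G\times H)/U_\phi$ with $U_\phi=\{(\phi(u)^{-1},u):u\in U\}$. For an $A$-fibered $(G,H)$-biset $X$ and an $A$-fibered $(H,I)$-biset $Y$, let $A\times H$ act on $X\times Y$ by $(a,h)\cdot(x,y)=((a^{-1},1,h)x,(a,h,1)y)$; the set of orbits $[x,y]$ is an $A\times G\times I$-set via $(a,g,i)[x,y]=[(a,g,1)x,(1,1,i)y]$, and $X\otimes_{AH}Y$ is its subset of elements with trivial stabilizer in $A$, an $A$-fibered $(G,I)$-biset. This tensor product is associative up to isomorphism. For $H\le G$ and $N\trianglelefteq G$ with canonical epimorphism $\pi\colon G\to G/N$: $\mathrm{Ind}_H^G=\left(\frac{G\times H}{\{(h,h):h\in H\},1}\right)$,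 $\mathrm{Res}^G_H=\left(\frac{H\times G}{\{(h,h):h\in H\},1}\right)$, $\mathrm{Inf}_{G/N}^G=\left(\frac{G\times G/N}{\{(g,\pi(g)):g\in G\},1}\right)$, $\mathrm{Def}^G_{G/N}=\left(\frac{G/N\times G}{\{(\pi(g),g):g\in G\},1}\right)$, where $1$ denotes the trivial homomorphism. *)

theory Defs
  imports "HOL-Algebra.Group_Action" "HOL-Algebra.Left_Coset"
begin

section \<open>Subgroups of a direct product\<close>

definition proj1 :: "('g \<times> 'h) set \<Rightarrow> 'g set"
  where "proj1 U = fst ` U"

definition proj2 :: "('g \<times> 'h) set \<Rightarrow> 'h set"
  where "proj2 U = snd ` U"

definition ker1 :: "('g, 'm) monoid_scheme \<Rightarrow> ('h, 'n) monoid_scheme \<Rightarrow> ('g \<times> 'h) set \<Rightarrow> 'g set"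
  where "ker1 G H U = {g \<in> carrier G. (g, \<one>\<^bsub>H\<^esub>) \<in> U}"

definition ker2 :: "('g, 'm) monoid_scheme \<Rightarrow> ('h, 'n) monoid_scheme \<Rightarrow> ('g \<times> 'h) set \<Rightarrow> 'h set"
  where "ker2 G H U = {h \<in> carrier H. (\<one>\<^bsub>G\<^esub>, h) \<in> U}"

text \<open>The set of pairs \<open>(K, \<kappa>)\<close> with \<open>K \<le> G\<close> and \<open>\<kappa> \<in> Hom(K, A)\<close>.\<close>

definition fibered_pairs ::
    "('a, 'k) monoid_scheme \<Rightarrow> ('g, 'm) monoid_scheme \<Rightarrow> ('g set \<times> ('g \<Rightarrow> 'a)) set"
  where "fibered_pairs A G = {(K, \<kappa>). subgroup K G \<and> \<kappa> \<in> hom (G\<lparr>carrier := K\<rparr>) A}"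

text \<open>The restrictions \<open>\<phi>\<^sub>1\<close>, \<open>\<phi>\<^sub>2\<close> are determined by \<open>\<phi>(g, h) = \<phi>\<^sub>1(g) \<phi>\<^sub>2(h)\<^sup>-\<^sup>1\<close>
  on \<open>k\<^sub>1(U) \<times> k\<^sub>2(U)\<close>; see \<open>restr_decomp\<close> and \<open>restr_unique\<close>.
  Note the inverse in \<open>\<phi>\<^sub>2\<close>.\<close>

definition restr1 :: "('h, 'n) monoid_scheme \<Rightarrow> ('g \<times> 'h \<Rightarrow> 'a) \<Rightarrow> 'g \<Rightarrow> 'a"
  where "restr1 H \<phi> = (\<lambda>g. \<phi> (g, \<one>\<^bsub>H\<^esub>))"

definition restr2 ::
    "('a, 'k) monoid_scheme \<Rightarrow> ('g, 'm) monoid_scheme \<Rightarrow> ('g \<times> 'h \<Rightarrow> 'a) \<Rightarrow> 'h \<Rightarrow> 'a"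
  where "restr2 A G \<phi> = (\<lambda>h. inv\<^bsub>A\<^esub> \<phi> (\<one>\<^bsub>G\<^esub>, h))"

lemma restr_decomp:
  assumes A: "comm_group A" and G: "group G" and H: "group H"
    and U: "(U, \<phi>) \<in> fibered_pairs A (G \<times>\<times> H)"
    and g: "g \<in> ker1 G H U" and h: "h \<in> ker2 G H U"
  shows "\<phi> (g, h) = restr1 H \<phi> g \<otimes>\<^bsub>A\<^esub> inv\<^bsub>A\<^esub> restr2 A G \<phi> h"
proof -
  interpret A: comm_group A by fact
  interpret G: group G by fact
  interpret H: group H by fact
  have hom: "\<phi> \<in> hom ((G \<times>\<times> H)\<lparr>carrier := U\<rparr>) A"
    using U by (simp add: fibered_pairs_def)
  have gU: "(g, \<one>\<^bsub>H\<^esub>) \<in> U" "g \<in> carrier G" and hU: "(\<one>\<^bsub>G\<^esub>, h) \<in> U" "h \<in> carrier H"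
    using g h by (auto simp: ker1_def ker2_def)
  have "\<phi> ((g, \<one>\<^bsub>H\<^esub>) \<otimes>\<^bsub>G \<times>\<times> H\<^esub> (\<one>\<^bsub>G\<^esub>, h)) = \<phi> (g, \<one>\<^bsub>H\<^esub>) \<otimes>\<^bsub>A\<^esub> \<phi> (\<one>\<^bsub>G\<^esub>, h)"
    by (rule hom_mult[OF hom, simplified]) (use gU hU in auto)
  moreover have "\<phi> (\<one>\<^bsub>G\<^esub>, h) \<in> carrier A"
    using hom hU by (auto simp: hom_def)
  ultimately show ?thesis
    using gU hU by (simp add: restr1_def restr2_def)
qed

lemma restr_unique:
  assumes A: "comm_group A" and G: "group G" and H: "group H"
    and U: "(U, \<phi>) \<in> fibered_pairs A (G \<times>\<times> H)"
    and f1: "f1 \<in> hom (G\<lparr>carrier := ker1 G H U\<rparr>) A"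
    and f2: "f2 \<in> hom (H\<lparr>carrier := ker2 G H U\<rparr>) A"
    and f: "\<And>g h. g \<in> ker1 G H U \<Longrightarrow> h \<in> ker2 G H U \<Longrightarrow> \<phi> (g, h) = f1 g \<otimes>\<^bsub>A\<^esub> inv\<^bsub>A\<^esub> f2 h"
  shows "g \<in> ker1 G H U \<Longrightarrow> f1 g = restr1 H \<phi> g"
    and "h \<in> ker2 G H U \<Longrightarrow> f2 h = restr2 A G \<phi> h"
proof -
  interpret A: comm_group A by fact
  interpret G: group G by fact
  interpret H: group H by fact
  have "subgroup U (G \<times>\<times> H)"
    using U by (simp add: fibered_pairs_def)
  then have "(\<one>\<^bsub>G\<^esub>, \<one>\<^bsub>H\<^esub>) \<in> U"
    using subgroup.one_closed by fastforce
  then have o: "\<one>\<^bsub>G\<^esub> \<in> ker1 G H U" "\<one>\<^bsub>H\<^esub> \<in> ker2 G H U"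
    by (auto simp: ker1_def ker2_def)
  have idem: "x = \<one>\<^bsub>A\<^esub>" if "x \<in> carrier A" "x \<otimes>\<^bsub>A\<^esub> x = x" for x
    using that by (metis A.l_cancel_one)
  have c1: "f1 x \<in> carrier A" if "x \<in> ker1 G H U" for x
    using f1 that by (auto simp: hom_def)
  have c2: "f2 x \<in> carrier A" if "x \<in> ker2 G H U" for x
    using f2 that by (auto simp: hom_def)
  have 1: "f1 \<one>\<^bsub>G\<^esub> = \<one>\<^bsub>A\<^esub>"
  proof (rule idem)
    have "f1 (\<one>\<^bsub>G\<^esub> \<otimes>\<^bsub>G\<^esub> \<one>\<^bsub>G\<^esub>) = f1 \<one>\<^bsub>G\<^esub> \<otimes>\<^bsub>A\<^esub> f1 \<one>\<^bsub>G\<^esub>"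
      by (rule hom_mult[OF f1, simplified]) (use o in auto)
    then show "f1 \<one>\<^bsub>G\<^esub> \<otimes>\<^bsub>A\<^esub> f1 \<one>\<^bsub>G\<^esub> = f1 \<one>\<^bsub>G\<^esub>" by simp
  qed (use c1 o in blast)
  have 2: "f2 \<one>\<^bsub>H\<^esub> = \<one>\<^bsub>A\<^esub>"
  proof (rule idem)
    have "f2 (\<one>\<^bsub>H\<^esub> \<otimes>\<^bsub>H\<^esub> \<one>\<^bsub>H\<^esub>) = f2 \<one>\<^bsub>H\<^esub> \<otimes>\<^bsub>A\<^esub> f2 \<one>\<^bsub>H\<^esub>"
      by (rule hom_mult[OF f2, simplified]) (use o in auto)
    then show "f2 \<one>\<^bsub>H\<^esub> \<otimes>\<^bsub>A\<^esub> f2 \<one>\<^bsub>H\<^esub> = f2 \<one>\<^bsub>H\<^esub>" by simp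
  qed (use c2 o in blast)
  show "f1 g = restr1 H \<phi> g" if "g \<in> ker1 G H U"
    using f[OF that o(2)] 2 c1[OF that] by (simp add: restr1_def)
  show "f2 h = restr2 A G \<phi> h" if "h \<in> ker2 G H U"
    using f[OF o(1) that] 1 c2[OF that] by (simp add: restr2_def)
qed


section \<open>Fibered bisets\<close>

record ('a, 'g, 'h, 'x) biset =
  pts :: "'x set"
  act :: "'a \<times> 'g \<times> 'h \<Rightarrow> 'x \<Rightarrow> 'x"

definition A_act ::
    "('g, 'm) monoid_scheme \<Rightarrow> ('h, 'n) monoid_scheme \<Rightarrow> ('a, 'g, 'h, 'x) biset \<Rightarrow> 'a \<Rightarrow> 'x \<Rightarrow> 'x"
  where "A_act G H X = (\<lambda>a. act X (a, \<one>\<^bsub>G\<^esub>, \<one>\<^bsub>H\<^esub>))"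

definition fibered_biset ::
    "('a, 'k) monoid_scheme \<Rightarrow> ('g, 'm) monoid_scheme \<Rightarrow> ('h, 'n) monoid_scheme
      \<Rightarrow> ('a, 'g, 'h, 'x) biset \<Rightarrow> bool"
  where "fibered_biset A G H X \<longleftrightarrow>
     group_action (A \<times>\<times> G \<times>\<times> H) (pts X) (act X) \<and>
     (\<forall>x \<in> pts X. stabilizer A (A_act G H X) x = {\<one>\<^bsub>A\<^esub>}) \<and>
     finite (orbits A (pts X) (A_act G H X))"

text \<open>Isomorphism of fibered bisets includes the assertion that both sides are fibered bisets.\<close>

definition biset_iso ::
    "('a, 'k) monoid_scheme \<Rightarrow> ('g, 'm) monoid_scheme \<Rightarrow> ('h, 'n) monoid_scheme
      \<Rightarrow> ('a, 'g, 'h, 'x) biset \<Rightarrow> ('a, 'g, 'h, 'y) biset \<Rightarrow> bool"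
  where "biset_iso A G H X Y \<longleftrightarrow>
     fibered_biset A G H X \<and> fibered_biset A G H Y \<and>
     (\<exists>f. bij_betw f (pts X) (pts Y) \<and>
          (\<forall>t \<in> carrier (A \<times>\<times> G \<times>\<times> H). \<forall>x \<in> pts X. f (act X t x) = act Y t (f x)))"

text \<open>The transitive biset \<open>(A \<times> G \<times> H) / U\<^sub>\<phi>\<close>: left cosets with left translation.\<close>

definition twisted_subgroup ::
    "('a, 'k) monoid_scheme \<Rightarrow> ('g \<times> 'h) set \<Rightarrow> ('g \<times> 'h \<Rightarrow> 'a) \<Rightarrow> ('a \<times> 'g \<times> 'h) set"
  where "twisted_subgroup A U \<phi> = {(inv\<^bsub>A\<^esub> \<phi> u, u) | u. u \<in> U}"

definition trans_biset ::
    "('a, 'k) monoid_scheme \<Rightarrow> ('g, 'm) monoid_scheme \<Rightarrow> ('h, 'n) monoid_scheme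
      \<Rightarrow> ('g \<times> 'h) set \<Rightarrow> ('g \<times> 'h \<Rightarrow> 'a) \<Rightarrow> ('a, 'g, 'h, ('a \<times> 'g \<times> 'h) set) biset"
  where "trans_biset A G H U \<phi> =
     (let S = lcosets\<^bsub>A \<times>\<times> G \<times>\<times> H\<^esub> (twisted_subgroup A U \<phi>) in
      \<lparr>pts = S, act = (\<lambda>t. \<lambda>C \<in> S. t <#\<^bsub>A \<times>\<times> G \<times>\<times> H\<^esub> C)\<rparr>)"


section \<open>The tensor product\<close>

text \<open>The action of \<open>A \<times> H\<close> on \<open>X \<times> Y\<close> whose orbits are the elements \<open>[x, y]\<close>.\<close>

definition tensor_action ::
    "('a, 'k) monoid_scheme \<Rightarrow> ('g, 'm) monoid_scheme \<Rightarrow> ('i, 'p) monoid_scheme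
      \<Rightarrow> ('a, 'g, 'h, 'x) biset \<Rightarrow> ('a, 'h, 'i, 'y) biset \<Rightarrow> 'a \<times> 'h \<Rightarrow> 'x \<times> 'y \<Rightarrow> 'x \<times> 'y"
  where "tensor_action A G I X Y =
     (\<lambda>(a, h). \<lambda>(x, y) \<in> pts X \<times> pts Y.
        (act X (inv\<^bsub>A\<^esub> a, \<one>\<^bsub>G\<^esub>, h) x, act Y (a, h, \<one>\<^bsub>I\<^esub>) y))"

text \<open>The action of \<open>(a, g, i)\<close> on an orbit is taken as the image of the orbit (a set of pairs)
  under \<open>(x, y) \<mapsto> ((a, g, 1) x, (1, 1, i) y)\<close>; this map commutes with the action of \<open>A \<times> H\<close>,
  so the image of \<open>[x, y]\<close> is \<open>[(a, g, 1) x, (1, 1, i) y]\<close>.\<close>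

definition tensor ::
    "('a, 'k) monoid_scheme \<Rightarrow> ('g, 'm) monoid_scheme \<Rightarrow> ('h, 'n) monoid_scheme
      \<Rightarrow> ('i, 'p) monoid_scheme \<Rightarrow> ('a, 'g, 'h, 'x) biset \<Rightarrow> ('a, 'h, 'i, 'y) biset
      \<Rightarrow> ('a, 'g, 'i, ('x \<times> 'y) set) biset"
  where "tensor A G H I X Y =
     (let T = orbits (A \<times>\<times> H) (pts X \<times> pts Y) (tensor_action A G I X Y);
          m = (\<lambda>(a, g, i) \<omega>.
                 (\<lambda>(x, y). (act X (a, g, \<one>\<^bsub>H\<^esub>) x, act Y (\<one>\<^bsub>A\<^esub>, \<one>\<^bsub>H\<^esub>, i) y)) ` \<omega>);
          S = {\<omega> \<in> T. stabilizer A (\<lambda>a. m (a, \<one>\<^bsub>G\<^esub>, \<one>\<^bsub>I\<^esub>)) \<omega> = {\<one>\<^bsub>A\<^esub>}}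
      in \<lparr>pts = S, act = (\<lambda>t. \<lambda>\<omega> \<in> S. m t \<omega>)\<rparr>)"


section \<open>Elementary bisets\<close>

text \<open>\<open>Ind\<^sub>P\<^sup>G\<close> and \<open>Res\<^sup>G\<^sub>P\<close> for \<open>P \<le> G\<close>, and \<open>Inf\<close>, \<open>Def\<close> for \<open>N\<close> normal in \<open>G\<close>,
  where \<open>g \<mapsto> N g\<close> is the canonical epimorphism onto \<open>G Mod N\<close>.\<close>

definition Ind_biset where
  "Ind_biset A G P = trans_biset A G (G\<lparr>carrier := P\<rparr>) {(p, p) | p. p \<in> P} (\<lambda>_. \<one>\<^bsub>A\<^esub>)"

definition Res_biset where
  "Res_biset A G P = trans_biset A (G\<lparr>carrier := P\<rparr>) G {(p, p) | p. p \<in> P} (\<lambda>_. \<one>\<^bsub>A\<^esub>)"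

definition Inf_biset where
  "Inf_biset A G N =
     trans_biset A G (G Mod N) {(g, N #>\<^bsub>G\<^esub> g) | g. g \<in> carrier G} (\<lambda>_. \<one>\<^bsub>A\<^esub>)"

definition Def_biset where
  "Def_biset A G N =
     trans_biset A (G Mod N) G {(N #>\<^bsub>G\<^esub> g, g) | g. g \<in> carrier G} (\<lambda>_. \<one>\<^bsub>A\<^esub>)"


section \<open>The quotient of a subgroup of a direct product\<close>

text \<open>For \<open>M \<times> N\<close> normal in \<open>U\<close>, the quotient \<open>U / (M \<times> N)\<close> as a subgroup of
  \<open>(P / M) \<times> (Q / N)\<close>: the canonical isomorphism
  \<open>(P / M) \<times> (Q / N) \<cong> (P \<times> Q) / (M \<times> N)\<close> sends a pair of cosets \<open>(C, D)\<close> to \<open>C \<times> D\<close>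
  (cf. \<open>FactGroup_DirProd_multiplication_iso_set\<close>).\<close>

definition quot_subgroup ::
    "('g, 'm) monoid_scheme \<Rightarrow> ('h, 'n) monoid_scheme \<Rightarrow> ('g \<times> 'h) set
      \<Rightarrow> 'g set \<Rightarrow> 'h set \<Rightarrow> ('g set \<times> 'h set) set"
  where "quot_subgroup P Q U M N =
     {(C, D) \<in> carrier ((P Mod M) \<times>\<times> (Q Mod N)).
        C \<times> D \<in> carrier ((P \<times>\<times> Q)\<lparr>carrier := U\<rparr> Mod (M \<times> N))}"

text \<open>The homomorphism induced by \<open>\<phi>\<close>: the unique value of \<open>\<phi>\<close> on the coset \<open>C \<times> D\<close>.\<close>

definition quot_hom :: "('g \<times> 'h \<Rightarrow> 'a) \<Rightarrow> 'g set \<times> 'h set \<Rightarrow> 'a"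
  where "quot_hom \<phi> = (\<lambda>(C, D). the_elem (\<phi> ` (C \<times> D)))"

end

theory Submission
  imports Defs
begin

text \<open>
  All the bisets involved are transitive sets for their acting groups, and a transitive set is
  determined up to isomorphism by the stabilizer of one of its points. For \<open>(A \<times> G \<times> H) / U\<^sub>\<phi>\<close> the trivial coset has
  stabilizer \<open>U\<^sub>\<phi>\<close>, so it suffices to find a point with stabilizer \<open>U\<^sub>\<phi>\<close> in the fivefold tensor product
  and to see that this product is transitive.

  The key is \<open>transitive_at_tensor\<close>. Let \<open>x \<in> X\<close> and \<open>y \<in> Y\<close> have stabilizers \<open>S\<close> and \<open>T\<close> in transitive
  bisets \<open>X\<close> and \<open>Y\<close> with middle group \<open>H\<close>. The stabilizer of \<open>[x, y]\<close> is the composite of \<open>S\<close> and \<open>T\<close> as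
  relations between the outer groups, with the labels in \<open>A\<close> multiplied. If \<open>S\<close> projects onto
  \<open>H\<close>, the set of all orbits \<open>[x', y']\<close> is a single orbit of the outer groups, so the double coset sum of the
  general Mackey formula has one term. The passage to the elements with trivial stabilizer
  in \<open>A\<close> discards nothing as soon as the composite meets \<open>A\<close> trivially.

  Write \<open>P\<close>, \<open>Q\<close> for the projections of \<open>U\<close>, and \<open>Khat\<close>, \<open>Lhat\<close> for the kernels of the two restrictions of
  \<open>\<phi>\<close>. Reading the factors from left to right, the successive composites are
  \<open>{(1, p, Khat p)}\<close> over \<open>p \<in> P\<close>, then \<open>{(\<phi>(p, q)\<^sup>-\<^sup>1, p, Lhat q)}\<close>, \<open>{(\<phi>(p, q)\<^sup>-\<^sup>1, p, q)}\<close> and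
  again \<open>{(\<phi>(p, q)\<^sup>-\<^sup>1, p, q)}\<close> over \<open>(p, q) \<in> U\<close>. The last set is \<open>U\<^sub>\<phi>\<close>. The diagonal
  of \<open>P\<close>, from which the chain starts, and the first three composites each project onto the next
  middle group. The computation rests on the
  fact that \<open>U\<close> and \<open>\<phi>\<close> are invariant under multiplication by \<open>Khat \<times> Lhat\<close>, which
  therefore can be divided out and recovered without loss.
\<close>

section \<open>Transitive actions and their stabilizers\<close>

lemma group_actionI:
  assumes "group G"
    and ext: "\<And>g. g \<in> carrier G \<Longrightarrow> \<phi> g \<in> extensional E"
    and closed: "\<And>g x. g \<in> carrier G \<Longrightarrow> x \<in> E \<Longrightarrow> \<phi> g x \<in> E"
    and one: "\<And>x. x \<in> E \<Longrightarrow> \<phi> \<one>\<^bsub>G\<^esub> x = x"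
    and mult: "\<And>g h x. g \<in> carrier G \<Longrightarrow> h \<in> carrier G \<Longrightarrow> x \<in> E \<Longrightarrow>
      \<phi> (g \<otimes>\<^bsub>G\<^esub> h) x = \<phi> g (\<phi> h x)"
  shows "group_action G E \<phi>"
proof -
  interpret group G by fact
  have inverse: "\<phi> (inv\<^bsub>G\<^esub> g) (\<phi> g x) = x" "\<phi> g (\<phi> (inv\<^bsub>G\<^esub> g) x) = x"
    if "g \<in> carrier G" "x \<in> E" for g x
    using that one mult[of "inv\<^bsub>G\<^esub> g" g x] mult[of g "inv\<^bsub>G\<^esub> g" x] by simp_all
  have bij: "\<phi> g \<in> Bij E" if g: "g \<in> carrier G" for g
  proof -
    have "bij_betw (\<phi> g) E E"
      by (rule bij_betw_byWitness[where f' = "\<phi> (inv\<^bsub>G\<^esub> g)"]) (use g inverse closed in auto)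
    then show ?thesis
      using ext[OF g] by (simp add: Bij_def)
  qed
  have "\<phi> (g \<otimes>\<^bsub>G\<^esub> h) = compose E (\<phi> g) (\<phi> h)" if "g \<in> carrier G" "h \<in> carrier G" for g h
    by (rule extensionalityI[of _ E]) (use that ext mult in \<open>auto simp: compose_eq\<close>)
  then have "\<phi> \<in> hom G (BijGroup E)"
    using bij by (auto simp: hom_def BijGroup_def)
  then show ?thesis
    by (simp add: group_action_def group_hom_def group_hom_axioms_def group_BijGroup is_group)
qed

lemma (in group_action) translates_eq_iff:
  assumes "x \<in> E" and s: "s \<in> carrier G" and t: "t \<in> carrier G"
  shows "\<phi> s x = \<phi> t x \<longleftrightarrow> inv t \<otimes> s \<in> stabilizer G \<phi> x"
proof -
  interpret group G
    using group_hom group_hom.axioms(1) by auto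
  have "\<phi> (inv t \<otimes> s) x = \<phi> (inv t) (\<phi> s x)"
    using assms by (simp add: composition_rule)
  moreover have "\<phi> t (\<phi> (inv t) (\<phi> s x)) = \<phi> s x"
  proof -
    have "\<phi> t (\<phi> (inv t) (\<phi> s x)) = \<phi> (t \<otimes> (inv t \<otimes> s)) x"
      using assms by (simp add: composition_rule)
    also have "t \<otimes> (inv t \<otimes> s) = s"
      using s t by (simp flip: m_assoc)
    finally show ?thesis .
  qed
  moreover have "\<phi> (inv t) (\<phi> t x) = x"
    using orbit_sym_aux[OF t \<open>x \<in> E\<close> refl] .
  ultimately show ?thesis
    using s t by (auto simp: stabilizer_def)
qed

text \<open>The base point is kept explicit because a stabilizer is attached to a point; other points of the
  same orbit have conjugate stabilizers.\<close>

definition transitive_at where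
  "transitive_at A G H X x S \<longleftrightarrow>
     transitive_action (A \<times>\<times> G \<times>\<times> H) (pts X) (act X) \<and> x \<in> pts X \<and>
     stabilizer (A \<times>\<times> G \<times>\<times> H) (act X) x = S"

lemma transitive_atD:
  assumes "transitive_at A G H X x S"
  shows "group_action (A \<times>\<times> G \<times>\<times> H) (pts X) (act X)" and "x \<in> pts X"
    and "stabilizer (A \<times>\<times> G \<times>\<times> H) (act X) x = S"
    and "y \<in> pts X \<Longrightarrow> \<exists>t \<in> carrier (A \<times>\<times> G \<times>\<times> H). act X t x = y"
  using assms
  by (auto simp: transitive_at_def transitive_action_def transitive_action_axioms_def)

text \<open>The factor \<open>A\<close> is central in \<open>A \<times> G \<times> H\<close>, so all points of an orbit have the same
  stabilizer in \<open>A\<close>, and freeness can be tested at the base point.\<close>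

lemma A_stabilizer_trivial_if_transitive_at:
  fixes A :: "('a, 'k) monoid_scheme"
    and G :: "('g, 'm) monoid_scheme"
    and H :: "('h, 'n) monoid_scheme"
  assumes "comm_group A" and "group G" and "group H"
    and X: "transitive_at A G H X x S"
    and free: "\<And>a. (a, \<one>\<^bsub>G\<^esub>, \<one>\<^bsub>H\<^esub>) \<in> S \<Longrightarrow> a = \<one>\<^bsub>A\<^esub>"
    and y: "y \<in> pts X"
  shows "stabilizer A (A_act G H X) y = {\<one>\<^bsub>A\<^esub>}"
proof -
  interpret A: comm_group A by fact
  interpret G: group G by fact
  interpret H: group H by fact
  interpret act: group_action "A \<times>\<times> G \<times>\<times> H" "pts X" "act X"
    using transitive_atD(1)[OF X] .
  note x = transitive_atD(2)[OF X] and stab = transitive_atD(3)[OF X]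
  have closed: "act X t z \<in> pts X" if "t \<in> carrier (A \<times>\<times> G \<times>\<times> H)" "z \<in> pts X" for t z
    using act.element_image[OF that refl] .
  have mult: "act X (a, g, h) (act X (b, g', h') z) =
      act X (a \<otimes>\<^bsub>A\<^esub> b, g \<otimes>\<^bsub>G\<^esub> g', h \<otimes>\<^bsub>H\<^esub> h') z"
    if "(a, g, h) \<in> carrier (A \<times>\<times> G \<times>\<times> H)" "(b, g', h') \<in> carrier (A \<times>\<times> G \<times>\<times> H)"
      "z \<in> pts X" for a g h b g' h' z
    using act.composition_rule[OF that(3,1,2)] by simp
  have one: "act X (\<one>\<^bsub>A\<^esub>, \<one>\<^bsub>G\<^esub>, \<one>\<^bsub>H\<^esub>) y = y"
    using act.id_eq_one y by (metis one_DirProd restrict_apply')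
  have "a = \<one>\<^bsub>A\<^esub>" if a: "a \<in> carrier A" and fixed: "act X (a, \<one>\<^bsub>G\<^esub>, \<one>\<^bsub>H\<^esub>) y = y" for a
  proof -
    obtain b g h where t: "b \<in> carrier A" "g \<in> carrier G" "h \<in> carrier H"
      and y_eq: "y = act X (b, g, h) x"
      using transitive_atD(4)[OF X y] by auto
    have "act X (b, g, h) (act X (a, \<one>\<^bsub>G\<^esub>, \<one>\<^bsub>H\<^esub>) x) = act X (b, g, h) x"
      using fixed a t x by (simp add: y_eq mult A.m_comm)
    then have "act X (a, \<one>\<^bsub>G\<^esub>, \<one>\<^bsub>H\<^esub>) x = x"
      using act.inj_prop[of "(b, g, h)"] a t x closed by (auto simp: inj_on_def)
    then show ?thesis
      using a stab by (intro free) (auto simp: stabilizer_def)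
  qed
  then show ?thesis
    using one by (auto simp: stabilizer_def A_act_def)
qed

text \<open>Every \<open>A\<close>-orbit contains a translate of the base point under the finite group \<open>G \<times> H\<close>,
  so there are finitely many of them.\<close>

lemma fibered_biset_if_transitive_at:
  fixes A :: "('a, 'k) monoid_scheme"
    and G :: "('g, 'm) monoid_scheme"
    and H :: "('h, 'n) monoid_scheme"
  assumes "comm_group A" and "group G" and finG: "finite (carrier G)"
    and "group H" and finH: "finite (carrier H)"
    and X: "transitive_at A G H X x S"
    and free: "\<And>a. (a, \<one>\<^bsub>G\<^esub>, \<one>\<^bsub>H\<^esub>) \<in> S \<Longrightarrow> a = \<one>\<^bsub>A\<^esub>"
  shows "fibered_biset A G H X"
proof -
  interpret A: comm_group A by fact
  interpret G: group G by fact
  interpret H: group H by fact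
  interpret act: group_action "A \<times>\<times> G \<times>\<times> H" "pts X" "act X"
    using transitive_atD(1)[OF X] .
  note x = transitive_atD(2)[OF X] and trans = transitive_atD(4)[OF X]
  have mult: "act X (a, g, h) (act X (b, g', h') y) =
      act X (a \<otimes>\<^bsub>A\<^esub> b, g \<otimes>\<^bsub>G\<^esub> g', h \<otimes>\<^bsub>H\<^esub> h') y"
    if "(a, g, h) \<in> carrier (A \<times>\<times> G \<times>\<times> H)" "(b, g', h') \<in> carrier (A \<times>\<times> G \<times>\<times> H)"
      "y \<in> pts X" for a g h b g' h' y
    using act.composition_rule[OF that(3,1,2)] by simp
  have "stabilizer A (A_act G H X) y = {\<one>\<^bsub>A\<^esub>}" if "y \<in> pts X" for y
    using A_stabilizer_trivial_if_transitive_at[OF assms(1,2,4) X free that] .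
  moreover have "finite (orbits A (pts X) (A_act G H X))"
  proof -
    have "orbit A (A_act G H X) y \<in>
        (\<lambda>(g, h). orbit A (A_act G H X) (act X (\<one>\<^bsub>A\<^esub>, g, h) x)) ` (carrier G \<times> carrier H)"
      if y: "y \<in> pts X" for y
    proof -
      obtain b g h where t: "b \<in> carrier A" "g \<in> carrier G" "h \<in> carrier H"
        and y_eq: "y = act X (b, g, h) x"
        using trans[OF y] by auto
      have "act X (a, \<one>\<^bsub>G\<^esub>, \<one>\<^bsub>H\<^esub>) y =
          act X (a \<otimes>\<^bsub>A\<^esub> b, \<one>\<^bsub>G\<^esub>, \<one>\<^bsub>H\<^esub>) (act X (\<one>\<^bsub>A\<^esub>, g, h) x)"
        and "act X (a, \<one>\<^bsub>G\<^esub>, \<one>\<^bsub>H\<^esub>) (act X (\<one>\<^bsub>A\<^esub>, g, h) x) =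
          act X (a \<otimes>\<^bsub>A\<^esub> inv\<^bsub>A\<^esub> b, \<one>\<^bsub>G\<^esub>, \<one>\<^bsub>H\<^esub>) y" if "a \<in> carrier A" for a
        using that t x by (simp_all add: y_eq mult A.m_assoc)
      then have "orbit A (A_act G H X) y = orbit A (A_act G H X) (act X (\<one>\<^bsub>A\<^esub>, g, h) x)"
        using t unfolding orbit_def A_act_def by blast
      then show ?thesis
        using t by blast
    qed
    then have "orbits A (pts X) (A_act G H X) \<subseteq>
        (\<lambda>(g, h). orbit A (A_act G H X) (act X (\<one>\<^bsub>A\<^esub>, g, h) x)) ` (carrier G \<times> carrier H)"
      by (auto simp: orbits_def)
    then show ?thesis
      using finG finH by (meson finite_SigmaI finite_imageI finite_subset)
  qed
  ultimately show ?thesis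
    using act.group_action_axioms by (simp add: fibered_biset_def)
qed

text \<open>The isomorphism sends \<open>t x\<close> to \<open>t y\<close>. It is well defined and injective because
  \<open>s x = t x\<close> and \<open>s y = t y\<close> both mean that \<open>t\<^sup>-\<^sup>1 s\<close> lies in the common stabilizer.\<close>

lemma biset_iso_if_equal_stabilizers:
  fixes A :: "('a, 'k) monoid_scheme"
    and G :: "('g, 'm) monoid_scheme"
    and H :: "('h, 'n) monoid_scheme"
  assumes "comm_group A" and "group G" and "finite (carrier G)"
    and "group H" and "finite (carrier H)"
    and X: "transitive_at A G H X x S" and Y: "transitive_at A G H Y y S"
    and free: "\<And>a. (a, \<one>\<^bsub>G\<^esub>, \<one>\<^bsub>H\<^esub>) \<in> S \<Longrightarrow> a = \<one>\<^bsub>A\<^esub>"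
  shows "biset_iso A G H X Y"
proof -
  let ?T = "A \<times>\<times> G \<times>\<times> H"
  interpret T: group ?T
    using assms by (intro DirProd_group) (auto simp: comm_group_def)
  interpret X: group_action ?T "pts X" "act X"
    using transitive_atD(1)[OF X] .
  interpret Y: group_action ?T "pts Y" "act Y"
    using transitive_atD(1)[OF Y] .
  note x = transitive_atD(2)[OF X] and y = transitive_atD(2)[OF Y]
  have eq_iff: "act X s x = act X t x \<longleftrightarrow> act Y s y = act Y t y"
    if "s \<in> carrier ?T" "t \<in> carrier ?T" for s t
    using that X.translates_eq_iff[OF x that] Y.translates_eq_iff[OF y that]
    by (simp only: transitive_atD(3)[OF X] transitive_atD(3)[OF Y])
  define f where "f z = act Y (SOME t. t \<in> carrier ?T \<and> act X t x = z) y" for z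
  have f: "f (act X t x) = act Y t y" if t: "t \<in> carrier ?T" for t
  proof -
    let ?s = "SOME s. s \<in> carrier ?T \<and> act X s x = act X t x"
    have "?s \<in> carrier ?T \<and> act X ?s x = act X t x"
      by (rule someI[of _ t]) (use t in blast)
    then show ?thesis
      using eq_iff[of ?s t] t by (simp add: f_def)
  qed
  have "inj_on f (pts X)"
  proof (rule inj_onI)
    fix z z' assume zs: "z \<in> pts X" "z' \<in> pts X" and eq: "f z = f z'"
    obtain s t where "s \<in> carrier ?T" "act X s x = z" "t \<in> carrier ?T" "act X t x = z'"
      using transitive_atD(4)[OF X zs(1)] transitive_atD(4)[OF X zs(2)] by blast
    then show "z = z'"
      using eq eq_iff f by metis
  qed
  moreover have "f z \<in> pts Y" if z: "z \<in> pts X" for z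
  proof -
    obtain t where "t \<in> carrier ?T" "act X t x = z"
      using transitive_atD(4)[OF X z] by blast
    then show ?thesis
      using f Y.element_image[OF _ y] by metis
  qed
  moreover have "w \<in> f ` pts X" if w: "w \<in> pts Y" for w
  proof -
    obtain t where t: "t \<in> carrier ?T" "act Y t y = w"
      using transitive_atD(4)[OF Y w] by blast
    then have "w = f (act X t x)" "act X t x \<in> pts X"
      using f X.element_image[OF _ x] by auto
    then show ?thesis by blast
  qed
  ultimately have "bij_betw f (pts X) (pts Y)"
    by (auto simp: bij_betw_def)
  moreover have "f (act X t z) = act Y t (f z)" if t: "t \<in> carrier ?T" and z: "z \<in> pts X" for t z
  proof -
    obtain s where s: "s \<in> carrier ?T" and z_eq: "z = act X s x"
      using transitive_atD(4)[OF X z] by blast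
    have "act X t z = act X (t \<otimes>\<^bsub>?T\<^esub> s) x"
      using X.composition_rule[OF x t s] by (simp only: z_eq)
    also have "f \<dots> = act Y t (act Y s y)"
      using f[OF T.m_closed[OF t s]] Y.composition_rule[OF y t s] by simp
    also have "act Y s y = f z"
      using f[OF s] by (simp add: z_eq)
    finally show ?thesis .
  qed
  moreover have "fibered_biset A G H X" "fibered_biset A G H Y"
    using assms by (blast intro: fibered_biset_if_transitive_at)+
  ultimately show ?thesis
    unfolding biset_iso_def by blast
qed

lemma mem_twisted_subgroup_iff:
  "(a, u) \<in> twisted_subgroup A U \<phi> \<longleftrightarrow> u \<in> U \<and> a = inv\<^bsub>A\<^esub> \<phi> u"
  by (cases u) (auto simp: twisted_subgroup_def)

lemma subgroup_twisted_subgroup: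
  fixes A :: "('a, 'k) monoid_scheme"
    and G :: "('g, 'm) monoid_scheme"
    and H :: "('h, 'n) monoid_scheme"
  assumes "comm_group A" and "group G" and "group H"
    and U: "(U, \<phi>) \<in> fibered_pairs A (G \<times>\<times> H)"
  shows "subgroup (twisted_subgroup A U \<phi>) (A \<times>\<times> G \<times>\<times> H)"
proof -
  interpret A: comm_group A by fact
  interpret GH: group "G \<times>\<times> H" using assms by (intro DirProd_group)
  interpret U: subgroup U "G \<times>\<times> H" using U by (simp add: fibered_pairs_def)
  interpret \<phi>: group_hom "(G \<times>\<times> H)\<lparr>carrier := U\<rparr>" A \<phi>
    using U A.is_group GH.is_group U.subgroup_is_group
    by (auto simp: fibered_pairs_def group_hom_def group_hom_axioms_def)
  have "group (A \<times>\<times> G \<times>\<times> H)"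
    using A.is_group GH.is_group by (rule DirProd_group)
  then show ?thesis
  proof (rule group.subgroupI)
    show "twisted_subgroup A U \<phi> \<subseteq> carrier (A \<times>\<times> G \<times>\<times> H)"
      using U.subset \<phi>.hom_closed by (fastforce simp: twisted_subgroup_def)
    show "twisted_subgroup A U \<phi> \<noteq> {}"
      using U.one_closed by (auto simp: twisted_subgroup_def)
  next
    fix t assume "t \<in> twisted_subgroup A U \<phi>"
    then obtain u where u: "u \<in> U" and t: "t = (inv\<^bsub>A\<^esub> \<phi> u, u)"
      by (auto simp: twisted_subgroup_def)
    have "inv\<^bsub>A \<times>\<times> G \<times>\<times> H\<^esub> t = (inv\<^bsub>A\<^esub> (inv\<^bsub>A\<^esub> \<phi> u), inv\<^bsub>G \<times>\<times> H\<^esub> u)"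
      unfolding t using u U.subset \<phi>.hom_closed[of u]
      by (intro inv_DirProd) (auto intro: A.is_group GH.is_group)
    moreover have "\<phi> (inv\<^bsub>G \<times>\<times> H\<^esub> u) = inv\<^bsub>A\<^esub> \<phi> u"
      using \<phi>.hom_inv[of u] u GH.m_inv_consistent[OF U.subgroup_axioms u] by simp
    ultimately show "inv\<^bsub>A \<times>\<times> G \<times>\<times> H\<^esub> t \<in> twisted_subgroup A U \<phi>"
      using GH.is_group U.m_inv_closed[OF u] by (simp add: mem_twisted_subgroup_iff)
  next
    fix s t assume "s \<in> twisted_subgroup A U \<phi>" "t \<in> twisted_subgroup A U \<phi>"
    then obtain u v where u: "u \<in> U" "s = (inv\<^bsub>A\<^esub> \<phi> u, u)" and v: "v \<in> U" "t = (inv\<^bsub>A\<^esub> \<phi> v, v)"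
      by (auto simp: twisted_subgroup_def)
    have "s \<otimes>\<^bsub>A \<times>\<times> G \<times>\<times> H\<^esub> t = (inv\<^bsub>A\<^esub> \<phi> (u \<otimes>\<^bsub>G \<times>\<times> H\<^esub> v), u \<otimes>\<^bsub>G \<times>\<times> H\<^esub> v)"
      using u v \<phi>.hom_mult[of u v] \<phi>.hom_closed
      by (simp add: A.inv_mult_group A.m_comm)
    then show "s \<otimes>\<^bsub>A \<times>\<times> G \<times>\<times> H\<^esub> t \<in> twisted_subgroup A U \<phi>"
      using u v by (simp add: mem_twisted_subgroup_iff)
  qed
qed

lemma transitive_at_trans_biset:
  fixes A :: "('a, 'k) monoid_scheme"
    and G :: "('g, 'm) monoid_scheme"
    and H :: "('h, 'n) monoid_scheme"
  assumes "comm_group A" and "group G" and "group H"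
    and "(U, \<phi>) \<in> fibered_pairs A (G \<times>\<times> H)"
  shows "transitive_at A G H (trans_biset A G H U \<phi>)
    (twisted_subgroup A U \<phi>) (twisted_subgroup A U \<phi>)"
proof -
  let ?T = "A \<times>\<times> G \<times>\<times> H" and ?S = "twisted_subgroup A U \<phi>"
  let ?X = "trans_biset A G H U \<phi>"
  interpret T: group ?T
    using assms by (intro DirProd_group) (auto simp: comm_group_def)
  have sub: "subgroup ?S ?T"
    using assms by (rule subgroup_twisted_subgroup)
  note subset = subgroup.subset[OF sub]
  have pts: "pts ?X = (\<lambda>t. t <#\<^bsub>?T\<^esub> ?S) ` carrier ?T"
    by (auto simp: trans_biset_def LCOSETS_def Let_def)
  have act: "act ?X t = (\<lambda>C \<in> pts ?X. t <#\<^bsub>?T\<^esub> C)" for t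
    by (simp add: trans_biset_def Let_def)
  have assoc: "s <#\<^bsub>?T\<^esub> (t <#\<^bsub>?T\<^esub> ?S) = (s \<otimes>\<^bsub>?T\<^esub> t) <#\<^bsub>?T\<^esub> ?S"
    if "s \<in> carrier ?T" "t \<in> carrier ?T" for s t
    using T.lcos_m_assoc[OF subset that] .
  have act_coset: "act ?X s (t <#\<^bsub>?T\<^esub> ?S) = (s \<otimes>\<^bsub>?T\<^esub> t) <#\<^bsub>?T\<^esub> ?S"
    if "s \<in> carrier ?T" "t \<in> carrier ?T" for s t
    unfolding act using that assoc[OF that] by (auto simp: pts)
  have S_coset: "\<one>\<^bsub>?T\<^esub> <#\<^bsub>?T\<^esub> ?S = ?S"
    using T.lcos_mult_one[OF subset] .
  have S: "?S \<in> pts ?X"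
    using imageI[OF T.one_closed, of "\<lambda>t. t <#\<^bsub>?T\<^esub> ?S"] by (simp only: pts S_coset)
  have act_S: "act ?X t ?S = t <#\<^bsub>?T\<^esub> ?S" for t
    using S by (simp add: act)
  have action: "group_action ?T (pts ?X) (act ?X)"
  proof (rule group_actionI)
    show "act ?X t \<in> extensional (pts ?X)" for t
      by (simp add: act)
  next
    fix t C assume t: "t \<in> carrier ?T" and "C \<in> pts ?X"
    then obtain s where "s \<in> carrier ?T" "C = s <#\<^bsub>?T\<^esub> ?S" by (auto simp only: pts image_iff)
    then show "act ?X t C \<in> pts ?X"
      using t act_coset T.m_closed[OF t] by (simp only: pts) blast
  next
    fix C assume "C \<in> pts ?X"
    then obtain s where "s \<in> carrier ?T" "C = s <#\<^bsub>?T\<^esub> ?S" by (auto simp only: pts image_iff)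
    then show "act ?X \<one>\<^bsub>?T\<^esub> C = C"
      using act_coset[OF T.one_closed] T.l_one by metis
  next
    fix t t' C assume t: "t \<in> carrier ?T" "t' \<in> carrier ?T" and "C \<in> pts ?X"
    then obtain s where s: "s \<in> carrier ?T" "C = s <#\<^bsub>?T\<^esub> ?S" by (auto simp only: pts image_iff)
    show "act ?X (t \<otimes>\<^bsub>?T\<^esub> t') C = act ?X t (act ?X t' C)"
      unfolding s(2) using act_coset t s(1) T.m_closed T.m_assoc by metis
  qed (rule T.is_group)
  have "\<exists>t \<in> carrier ?T. act ?X t C = D" if C: "C \<in> pts ?X" and D: "D \<in> pts ?X" for C D
  proof -
    obtain s t where s: "s \<in> carrier ?T" "C = s <#\<^bsub>?T\<^esub> ?S" and t: "t \<in> carrier ?T" "D = t <#\<^bsub>?T\<^esub> ?S"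
      using C D by (auto simp only: pts image_iff)
    have ts: "t \<otimes>\<^bsub>?T\<^esub> inv\<^bsub>?T\<^esub> s \<in> carrier ?T"
      using s(1) t(1) by (simp del: carrier_DirProd)
    moreover have "t \<otimes>\<^bsub>?T\<^esub> inv\<^bsub>?T\<^esub> s \<otimes>\<^bsub>?T\<^esub> s = t"
      using s(1) t(1) by (simp add: T.m_assoc del: carrier_DirProd one_DirProd)
    then have "act ?X (t \<otimes>\<^bsub>?T\<^esub> inv\<^bsub>?T\<^esub> s) C = D"
      unfolding s(2) t(2) act_coset[OF ts s(1)] by (rule arg_cong)
    ultimately show ?thesis
      by (intro bexI)
  qed
  moreover have "stabilizer ?T (act ?X) ?S = ?S"
  proof -
    have "t <#\<^bsub>?T\<^esub> ?S = ?S \<longleftrightarrow> t \<in> ?S" if "t \<in> carrier ?T" for t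
      using T.lcos_self[OF that sub] T.coset_join3[OF that sub] by blast
    then show ?thesis
      using subset by (auto simp only: stabilizer_def act_S)
  qed
  ultimately show ?thesis
    using S action by (simp add: transitive_at_def transitive_action_def transitive_action_axioms_def)
qed


section \<open>Tensor products of transitive bisets\<close>

text \<open>The composite of \<open>S\<close> and \<open>T\<close> as relations labelled by elements of \<open>A\<close>. For
  \<open>S = U\<^sub>\<phi>\<close> and \<open>T = V\<^sub>\<psi>\<close> it labels \<open>(g, i)\<close> by the products \<open>\<phi>(g, h)\<^sup>-\<^sup>1 \<psi>(h, i)\<^sup>-\<^sup>1\<close>;
  they do not depend on the choice of \<open>h\<close> exactly when the composite meets \<open>A\<close> trivially.\<close>

definition stabilizer_comp where
  "stabilizer_comp A S T =
     {(a \<otimes>\<^bsub>A\<^esub> b, g, i) | a b g h i. (a, g, h) \<in> S \<and> (b, h, i) \<in> T}"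

text \<open>The orbit \<open>[x, y]\<close> is fixed by \<open>(a, g, i)\<close> if and only if some \<open>(b, h)\<close> in \<open>A \<times> H\<close> carries
  \<open>(x, y)\<close> to \<open>((a, g, 1) x, (1, 1, i) y)\<close>, that is, if \<open>(b a, g, h\<^sup>-\<^sup>1)\<close> fixes \<open>x\<close> and
  \<open>(b\<^sup>-\<^sup>1, h\<^sup>-\<^sup>1, i)\<close> fixes \<open>y\<close>; the two labels have product \<open>a\<close>. For
  transitivity, the action of \<open>A \<times> H\<close> moves all middle coordinates to the left factor,
  and since \<open>S\<close> projects onto \<open>H\<close>, any \<open>(1, 1, h) x\<close> is a translate of \<open>x\<close> under \<open>A \<times> G\<close>.\<close>

lemma transitive_at_tensor:
  fixes A :: "('a, 'k) monoid_scheme"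
    and G :: "('g, 'm) monoid_scheme"
    and H :: "('h, 'n) monoid_scheme"
    and I :: "('i, 'p) monoid_scheme"
  assumes "comm_group A" and "group G" and "group H" and "group I"
    and X: "transitive_at A G H X x S" and Y: "transitive_at A H I Y y T"
    and surj: "\<And>h. h \<in> carrier H \<Longrightarrow> \<exists>a g. (a, g, h) \<in> S"
    and free: "\<And>a. (a, \<one>\<^bsub>G\<^esub>, \<one>\<^bsub>I\<^esub>) \<in> stabilizer_comp A S T \<Longrightarrow> a = \<one>\<^bsub>A\<^esub>"
  shows "transitive_at A G I (tensor A G H I X Y)
    (orbit (A \<times>\<times> H) (tensor_action A G I X Y) (x, y)) (stabilizer_comp A S T)"
proof -
  interpret A: comm_group A by fact
  interpret G: group G by fact
  interpret H: group H by fact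
  interpret I: group I by fact
  have GH: "group (G \<times>\<times> H)" and HI: "group (H \<times>\<times> I)" and AH: "group (A \<times>\<times> H)"
    and AGI: "group (A \<times>\<times> G \<times>\<times> I)"
    by (intro DirProd_group A.is_group G.is_group H.is_group I.is_group)+
  interpret X: group_action "A \<times>\<times> G \<times>\<times> H" "pts X" "act X"
    using transitive_atD(1)[OF X] .
  interpret Y: group_action "A \<times>\<times> H \<times>\<times> I" "pts Y" "act Y"
    using transitive_atD(1)[OF Y] .
  note x = transitive_atD(2)[OF X] and stabX = transitive_atD(3)[OF X]
  note y = transitive_atD(2)[OF Y] and stabY = transitive_atD(3)[OF Y]
  have closedX: "act X (a, g, h) z \<in> pts X"
    if "a \<in> carrier A" "g \<in> carrier G" "h \<in> carrier H" "z \<in> pts X" for a g h z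
    using that X.element_image[of "(a, g, h)" z] by simp
  have closedY: "act Y (a, h, i) z \<in> pts Y"
    if "a \<in> carrier A" "h \<in> carrier H" "i \<in> carrier I" "z \<in> pts Y" for a h i z
    using that Y.element_image[of "(a, h, i)" z] by simp
  have multX: "act X (a, g, h) (act X (b, g', h') z) =
      act X (a \<otimes>\<^bsub>A\<^esub> b, g \<otimes>\<^bsub>G\<^esub> g', h \<otimes>\<^bsub>H\<^esub> h') z"
    if "a \<in> carrier A" "g \<in> carrier G" "h \<in> carrier H"
      "b \<in> carrier A" "g' \<in> carrier G" "h' \<in> carrier H" "z \<in> pts X" for a g h b g' h' z
    using that X.composition_rule[of z "(a, g, h)" "(b, g', h')"] by simp
  have multY: "act Y (a, h, i) (act Y (b, h', i') z) =
      act Y (a \<otimes>\<^bsub>A\<^esub> b, h \<otimes>\<^bsub>H\<^esub> h', i \<otimes>\<^bsub>I\<^esub> i') z"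
    if "a \<in> carrier A" "h \<in> carrier H" "i \<in> carrier I"
      "b \<in> carrier A" "h' \<in> carrier H" "i' \<in> carrier I" "z \<in> pts Y" for a h i b h' i' z
    using that Y.composition_rule[of z "(a, h, i)" "(b, h', i')"] by simp
  have oneX: "act X (\<one>\<^bsub>A\<^esub>, \<one>\<^bsub>G\<^esub>, \<one>\<^bsub>H\<^esub>) z = z" if "z \<in> pts X" for z
    using X.id_eq_one that by (metis one_DirProd restrict_apply')
  have oneY: "act Y (\<one>\<^bsub>A\<^esub>, \<one>\<^bsub>H\<^esub>, \<one>\<^bsub>I\<^esub>) z = z" if "z \<in> pts Y" for z
    using Y.id_eq_one that by (metis one_DirProd restrict_apply')

  define \<theta> where "\<theta> = tensor_action A G I X Y"
  define E where "E = pts X \<times> pts Y"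
  have \<theta>: "\<theta> (a, h) (x', y') = (act X (inv\<^bsub>A\<^esub> a, \<one>\<^bsub>G\<^esub>, h) x', act Y (a, h, \<one>\<^bsub>I\<^esub>) y')"
    if "x' \<in> pts X" "y' \<in> pts Y" for a h x' y'
    using that by (simp add: \<theta>_def tensor_action_def)
  have "group_action (A \<times>\<times> H) E \<theta>"
  proof (rule group_actionI[OF AH])
    show "\<theta> c \<in> extensional E" for c
      by (cases c) (simp add: \<theta>_def tensor_action_def E_def)
  qed (auto simp: E_def \<theta> closedX closedY oneX oneY multX multY A.inv_mult A.m_comm)
  then interpret \<theta>: group_action "A \<times>\<times> H" E \<theta> .
  define cls where "cls = orbit (A \<times>\<times> H) \<theta>"
  have cls_eqI: "cls p = cls (\<theta> (b, h) p)" if "b \<in> carrier A" "h \<in> carrier H" "p \<in> E" for b h p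
  proof -
    have q: "\<theta> (b, h) p \<in> E" "\<theta> (b, h) p \<in> cls p"
      using that \<theta>.element_image[of "(b, h)" p] by (auto simp: cls_def orbit_def)
    moreover have "\<theta> (b, h) p \<in> cls (\<theta> (b, h) p)"
      using \<theta>.orbit_refl[OF q(1)] by (simp add: cls_def)
    ultimately have "cls p \<inter> cls (\<theta> (b, h) p) \<noteq> {}"
      by blast
    moreover have "cls p \<in> orbits (A \<times>\<times> H) E \<theta>" "cls (\<theta> (b, h) p) \<in> orbits (A \<times>\<times> H) E \<theta>"
      using that(3) q(1) unfolding orbits_def cls_def by blast+
    ultimately show ?thesis
      using \<theta>.disjoint_union by blast
  qed
  have cls_eqD: "\<exists>b \<in> carrier A. \<exists>h \<in> carrier H. \<theta> (b, h) p = q" if "cls p = cls q" "q \<in> E" for p q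
  proof -
    have "q \<in> cls p"
      using that \<theta>.orbit_refl by (simp add: cls_def)
    then show ?thesis
      by (auto simp: cls_def orbit_def)
  qed

  define \<tau> where
    "\<tau> = (\<lambda>(a, g, i) (x', y'). (act X (a, g, \<one>\<^bsub>H\<^esub>) x', act Y (\<one>\<^bsub>A\<^esub>, \<one>\<^bsub>H\<^esub>, i) y'))"
  have \<tau>: "\<tau> (a, g, i) (x', y') = (act X (a, g, \<one>\<^bsub>H\<^esub>) x', act Y (\<one>\<^bsub>A\<^esub>, \<one>\<^bsub>H\<^esub>, i) y')"
    for a g i x' y'
    by (simp add: \<tau>_def)
  have \<tau>_closed: "\<tau> t p \<in> E" if "t \<in> carrier (A \<times>\<times> G \<times>\<times> I)" "p \<in> E" for t p
    using that by (auto simp: E_def \<tau> closedX closedY)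
  have commute: "\<tau> t (\<theta> c p) = \<theta> c (\<tau> t p)"
    if "t \<in> carrier (A \<times>\<times> G \<times>\<times> I)" "c \<in> carrier (A \<times>\<times> H)" "p \<in> E" for t c p
    using that by (auto simp: E_def \<tau> \<theta> closedX closedY multX multY A.m_comm)
  have \<tau>_mult: "\<tau> (s \<otimes>\<^bsub>A \<times>\<times> G \<times>\<times> I\<^esub> t) p = \<tau> s (\<tau> t p)"
    if "s \<in> carrier (A \<times>\<times> G \<times>\<times> I)" "t \<in> carrier (A \<times>\<times> G \<times>\<times> I)" "p \<in> E" for s t p
    using that by (auto simp: E_def \<tau> multX multY)
  have \<tau>_one: "\<tau> \<one>\<^bsub>A \<times>\<times> G \<times>\<times> I\<^esub> p = p" if "p \<in> E" for p
    using that by (auto simp: E_def \<tau> oneX oneY)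
  have \<tau>_cls: "\<tau> t ` cls p = cls (\<tau> t p)"
    if "t \<in> carrier (A \<times>\<times> G \<times>\<times> I)" "p \<in> E" for t p
  proof -
    have "\<tau> t ` cls p = {\<tau> t (\<theta> c p) | c. c \<in> carrier (A \<times>\<times> H)}"
      unfolding cls_def orbit_def by blast
    also have "\<dots> = cls (\<tau> t p)"
      unfolding cls_def orbit_def using commute[OF that(1) _ that(2)] by metis
    finally show ?thesis .
  qed

  \<comment> \<open>The biset of all orbits, before the restriction to trivial stabilizers in \<open>A\<close>;
    it turns out to be the tensor product itself.\<close>
  define Z where "Z = \<lparr>pts = cls ` E, act = \<lambda>t. \<lambda>\<omega> \<in> cls ` E. \<tau> t ` \<omega>\<rparr>"
  have act_Z: "act Z t (cls p) = cls (\<tau> t p)" if "t \<in> carrier (A \<times>\<times> G \<times>\<times> I)" "p \<in> E" for t p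
    using that by (simp add: Z_def \<tau>_cls)
  have xy: "(x, y) \<in> E"
    using x y by (simp add: E_def)
  have action: "group_action (A \<times>\<times> G \<times>\<times> I) (pts Z) (act Z)"
  proof (rule group_actionI[OF AGI])
    show "act Z t \<in> extensional (pts Z)" for t
      by (simp add: Z_def)
  next
    fix t \<omega> assume t: "t \<in> carrier (A \<times>\<times> G \<times>\<times> I)" and "\<omega> \<in> pts Z"
    then obtain p where p: "p \<in> E" "\<omega> = cls p" by (auto simp: Z_def)
    show "act Z t \<omega> \<in> pts Z"
      unfolding p(2) act_Z[OF t p(1)] using \<tau>_closed[OF t p(1)] by (simp add: Z_def)
  next
    fix \<omega> assume "\<omega> \<in> pts Z"
    then obtain p where p: "p \<in> E" "\<omega> = cls p" by (auto simp: Z_def)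
    have "\<one>\<^bsub>A \<times>\<times> G \<times>\<times> I\<^esub> \<in> carrier (A \<times>\<times> G \<times>\<times> I)"
      using group.is_monoid[OF AGI] by (rule monoid.one_closed)
    then show "act Z \<one>\<^bsub>A \<times>\<times> G \<times>\<times> I\<^esub> \<omega> = \<omega>"
      unfolding p(2) using act_Z[OF _ p(1)] \<tau>_one[OF p(1)] by presburger
  next
    fix s t \<omega>
    assume st: "s \<in> carrier (A \<times>\<times> G \<times>\<times> I)" "t \<in> carrier (A \<times>\<times> G \<times>\<times> I)" and "\<omega> \<in> pts Z"
    then obtain p where p: "p \<in> E" "\<omega> = cls p" by (auto simp: Z_def)
    have "s \<otimes>\<^bsub>A \<times>\<times> G \<times>\<times> I\<^esub> t \<in> carrier (A \<times>\<times> G \<times>\<times> I)"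
      using group.is_monoid[OF AGI] st by (rule monoid.m_closed)
    then show "act Z (s \<otimes>\<^bsub>A \<times>\<times> G \<times>\<times> I\<^esub> t) \<omega> = act Z s (act Z t \<omega>)"
      unfolding p(2) act_Z[OF st(2) p(1)] act_Z[OF st(1) \<tau>_closed[OF st(2) p(1)]]
      using act_Z[OF _ p(1)] \<tau>_mult[OF st p(1)] by presburger
  qed
  then interpret Z: group_action "A \<times>\<times> G \<times>\<times> I" "pts Z" "act Z" .

  have reach: "\<exists>t \<in> carrier (A \<times>\<times> G \<times>\<times> I). act Z t (cls (x, y)) = \<omega>" if \<omega>_pts: "\<omega> \<in> pts Z" for \<omega>
  proof -
    obtain x' y' where xy': "x' \<in> pts X" "y' \<in> pts Y" and \<omega>: "\<omega> = cls (x', y')"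
      using \<omega>_pts by (auto simp: Z_def E_def)
    obtain a g h where t: "a \<in> carrier A" "g \<in> carrier G" "h \<in> carrier H"
      and x': "x' = act X (a, g, h) x"
      using transitive_atD(4)[OF X xy'(1)] by auto
    obtain b k i where u: "b \<in> carrier A" "k \<in> carrier H" "i \<in> carrier I"
      and y': "y' = act Y (b, k, i) y"
      using transitive_atD(4)[OF Y xy'(2)] by auto
    \<comment> \<open>After the middle coordinate of \<open>y'\<close> has been moved to the left, that of \<open>x'\<close> becomes
      \<open>k\<^sup>-\<^sup>1 h\<close>; an element of \<open>S\<close> over it trades it for elements of \<open>A\<close> and \<open>G\<close>.\<close>
    obtain a0 g0 where "(a0, g0, inv\<^bsub>H\<^esub> k \<otimes>\<^bsub>H\<^esub> h) \<in> S"
      using surj[of "inv\<^bsub>H\<^esub> k \<otimes>\<^bsub>H\<^esub> h"] t u by auto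
    then have t0: "a0 \<in> carrier A" "g0 \<in> carrier G"
      and fixed: "act X (a0, g0, inv\<^bsub>H\<^esub> k \<otimes>\<^bsub>H\<^esub> h) x = x"
      using stabX by (auto simp: stabilizer_def)
    let ?a = "a \<otimes>\<^bsub>A\<^esub> inv\<^bsub>A\<^esub> a0" and ?g = "g \<otimes>\<^bsub>G\<^esub> inv\<^bsub>G\<^esub> g0"
    have "act X (?a, ?g, k) x = act X (?a, ?g, k) (act X (a0, g0, inv\<^bsub>H\<^esub> k \<otimes>\<^bsub>H\<^esub> h) x)"
      by (simp add: fixed)
    also have "\<dots> = x'"
      using t t0 u x by (simp add: x' multX A.m_assoc G.m_assoc flip: H.m_assoc)
    finally have x'_eq: "act X (?a, ?g, k) x = x'" .
    have "inv\<^bsub>A\<^esub> b \<otimes>\<^bsub>A\<^esub> (b \<otimes>\<^bsub>A\<^esub> ?a) = ?a"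
      using t t0 u by (simp flip: A.m_assoc)
    then have "\<theta> (b, k) (\<tau> (b \<otimes>\<^bsub>A\<^esub> ?a, ?g, i) (x, y)) = (x', y')"
      using t t0 u x y by (simp add: \<theta> \<tau> closedX closedY multX multY x'_eq y')
    moreover have c: "(b \<otimes>\<^bsub>A\<^esub> ?a, ?g, i) \<in> carrier (A \<times>\<times> G \<times>\<times> I)"
      using t t0 u by simp
    ultimately have "act Z (b \<otimes>\<^bsub>A\<^esub> ?a, ?g, i) (cls (x, y)) = \<omega>"
      using cls_eqI[OF u(1,2) \<tau>_closed[OF c xy]] act_Z[OF c xy] by (simp add: \<omega>)
    then show ?thesis
      using c by blast
  qed

  have stab_iff: "act Z (a, g, i) (cls (x, y)) = cls (x, y) \<longleftrightarrow> (a, g, i) \<in> stabilizer_comp A S T"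
    if t: "a \<in> carrier A" "g \<in> carrier G" "i \<in> carrier I" for a g i
  proof -
    have \<theta>_iff: "\<theta> (b, h) (x, y) = \<tau> (a, g, i) (x, y) \<longleftrightarrow>
        (b \<otimes>\<^bsub>A\<^esub> a, g, inv\<^bsub>H\<^esub> h) \<in> S \<and> (inv\<^bsub>A\<^esub> b, inv\<^bsub>H\<^esub> h, i) \<in> T"
      if "b \<in> carrier A" "h \<in> carrier H" for b h
    proof -
      have "act X (a, g, \<one>\<^bsub>H\<^esub>) x = act X (inv\<^bsub>A\<^esub> b, \<one>\<^bsub>G\<^esub>, h) x \<longleftrightarrow>
          (b \<otimes>\<^bsub>A\<^esub> a, g, inv\<^bsub>H\<^esub> h) \<in> S"
        using X.translates_eq_iff[OF x, of "(a, g, \<one>\<^bsub>H\<^esub>)" "(inv\<^bsub>A\<^esub> b, \<one>\<^bsub>G\<^esub>, h)"] that t GH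
        by (simp add: stabX)
      moreover have "act Y (\<one>\<^bsub>A\<^esub>, \<one>\<^bsub>H\<^esub>, i) y = act Y (b, h, \<one>\<^bsub>I\<^esub>) y \<longleftrightarrow>
          (inv\<^bsub>A\<^esub> b, inv\<^bsub>H\<^esub> h, i) \<in> T"
        using Y.translates_eq_iff[OF y, of "(\<one>\<^bsub>A\<^esub>, \<one>\<^bsub>H\<^esub>, i)" "(b, h, \<one>\<^bsub>I\<^esub>)"] that t HI
        by (simp add: stabY)
      ultimately show ?thesis
        using x y by (auto simp: \<theta> \<tau>)
    qed
    have c: "(a, g, i) \<in> carrier (A \<times>\<times> G \<times>\<times> I)"
      using t by simp
    have "act Z (a, g, i) (cls (x, y)) = cls (x, y) \<longleftrightarrow>
        (\<exists>b \<in> carrier A. \<exists>h \<in> carrier H. \<theta> (b, h) (x, y) = \<tau> (a, g, i) (x, y))"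
      using cls_eqD[of "(x, y)" "\<tau> (a, g, i) (x, y)"] cls_eqI[OF _ _ xy] \<tau>_closed[OF c xy]
      unfolding act_Z[OF c xy] by metis
    also have "\<dots> \<longleftrightarrow> (\<exists>b \<in> carrier A. \<exists>h \<in> carrier H.
        (b \<otimes>\<^bsub>A\<^esub> a, g, inv\<^bsub>H\<^esub> h) \<in> S \<and> (inv\<^bsub>A\<^esub> b, inv\<^bsub>H\<^esub> h, i) \<in> T)"
      by (simp add: \<theta>_iff)
    also have "\<dots> \<longleftrightarrow> (a, g, i) \<in> stabilizer_comp A S T"
    proof
      assume "\<exists>b \<in> carrier A. \<exists>h \<in> carrier H.
        (b \<otimes>\<^bsub>A\<^esub> a, g, inv\<^bsub>H\<^esub> h) \<in> S \<and> (inv\<^bsub>A\<^esub> b, inv\<^bsub>H\<^esub> h, i) \<in> T"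
      then obtain b h where b: "b \<in> carrier A"
        and ST: "(b \<otimes>\<^bsub>A\<^esub> a, g, inv\<^bsub>H\<^esub> h) \<in> S" "(inv\<^bsub>A\<^esub> b, inv\<^bsub>H\<^esub> h, i) \<in> T"
        by blast
      have "a = b \<otimes>\<^bsub>A\<^esub> a \<otimes>\<^bsub>A\<^esub> inv\<^bsub>A\<^esub> b"
        unfolding A.m_comm[OF b t(1)] using b t by (simp add: A.m_assoc)
      then show "(a, g, i) \<in> stabilizer_comp A S T"
        using ST unfolding stabilizer_comp_def by blast
    next
      assume "(a, g, i) \<in> stabilizer_comp A S T"
      then obtain a1 a2 h where a: "a = a1 \<otimes>\<^bsub>A\<^esub> a2" and ST: "(a1, g, h) \<in> S" "(a2, h, i) \<in> T"
        by (auto simp: stabilizer_comp_def)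
      have c: "a1 \<in> carrier A" "a2 \<in> carrier A" "h \<in> carrier H"
        using ST stabX stabY by (auto simp: stabilizer_def)
      then have "inv\<^bsub>A\<^esub> a2 \<otimes>\<^bsub>A\<^esub> a = a1"
        by (simp add: a A.m_lcomm)
      then show "\<exists>b \<in> carrier A. \<exists>h \<in> carrier H.
          (b \<otimes>\<^bsub>A\<^esub> a, g, inv\<^bsub>H\<^esub> h) \<in> S \<and> (inv\<^bsub>A\<^esub> b, inv\<^bsub>H\<^esub> h, i) \<in> T"
        using c ST by (intro bexI[of _ "inv\<^bsub>A\<^esub> a2"] bexI[of _ "inv\<^bsub>H\<^esub> h"]) auto
    qed
    finally show ?thesis .
  qed
  have comp_subset: "stabilizer_comp A S T \<subseteq> carrier (A \<times>\<times> G \<times>\<times> I)"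
    using stabX stabY by (auto simp: stabilizer_comp_def stabilizer_def)
  have "stabilizer (A \<times>\<times> G \<times>\<times> I) (act Z) (cls (x, y)) = stabilizer_comp A S T"
  proof (rule Set.set_eqI)
    fix t :: "'a \<times> 'g \<times> 'i"
    obtain a g i where t: "t = (a, g, i)" by (cases t)
    show "t \<in> stabilizer (A \<times>\<times> G \<times>\<times> I) (act Z) (cls (x, y)) \<longleftrightarrow> t \<in> stabilizer_comp A S T"
      using comp_subset stab_iff[of a g i] unfolding t stabilizer_def carrier_DirProd by blast
  qed
  moreover have "\<exists>t \<in> carrier (A \<times>\<times> G \<times>\<times> I). act Z t \<omega> = \<omega>'"
    if \<omega>: "\<omega> \<in> pts Z" and \<omega>': "\<omega>' \<in> pts Z" for \<omega> \<omega>'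
  proof -
    obtain s t where s: "s \<in> carrier (A \<times>\<times> G \<times>\<times> I)" "act Z s (cls (x, y)) = \<omega>"
      and t: "t \<in> carrier (A \<times>\<times> G \<times>\<times> I)" "act Z t (cls (x, y)) = \<omega>'"
      using reach[OF \<omega>] reach[OF \<omega>'] by blast
    have xyZ: "cls (x, y) \<in> pts Z"
      using xy by (simp add: Z_def)
    have inv_s: "inv\<^bsub>A \<times>\<times> G \<times>\<times> I\<^esub> s \<in> carrier (A \<times>\<times> G \<times>\<times> I)"
      using AGI s(1) by (rule group.inv_closed)
    have "act Z (t \<otimes>\<^bsub>A \<times>\<times> G \<times>\<times> I\<^esub> inv\<^bsub>A \<times>\<times> G \<times>\<times> I\<^esub> s) \<omega> = \<omega>'"
      using Z.composition_rule[OF \<omega> t(1) inv_s] Z.orbit_sym_aux[OF s(1) xyZ s(2)] t(2)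
      by simp
    moreover have "t \<otimes>\<^bsub>A \<times>\<times> G \<times>\<times> I\<^esub> inv\<^bsub>A \<times>\<times> G \<times>\<times> I\<^esub> s \<in> carrier (A \<times>\<times> G \<times>\<times> I)"
      using group.is_monoid[OF AGI] t(1) inv_s by (rule monoid.m_closed)
    ultimately show ?thesis
      by (rule bexI)
  qed
  ultimately have Z: "transitive_at A G I Z (cls (x, y)) (stabilizer_comp A S T)"
    using xy action
    by (auto simp: transitive_at_def transitive_action_def transitive_action_axioms_def Z_def)

  have "stabilizer A (A_act G I Z) \<omega> = {\<one>\<^bsub>A\<^esub>}" if "\<omega> \<in> cls ` E" for \<omega>
    using A_stabilizer_trivial_if_transitive_at[OF assms(1,2,4) Z free] that by (simp add: Z_def)
  moreover have "stabilizer A (A_act G I Z) \<omega> =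
      stabilizer A (\<lambda>a. image (\<tau> (a, \<one>\<^bsub>G\<^esub>, \<one>\<^bsub>I\<^esub>))) \<omega>" if "\<omega> \<in> cls ` E" for \<omega>
    using that by (simp add: A_act_def Z_def stabilizer_def)
  ultimately have trivial: "{\<omega> \<in> cls ` E. stabilizer A (\<lambda>a. image (\<tau> (a, \<one>\<^bsub>G\<^esub>, \<one>\<^bsub>I\<^esub>))) \<omega> = {\<one>\<^bsub>A\<^esub>}}
      = cls ` E"
    by auto
  have T: "orbits (A \<times>\<times> H) (pts X \<times> pts Y) (tensor_action A G I X Y) = cls ` E"
    by (auto simp: orbits_def cls_def \<theta>_def E_def)
  have \<tau>_image: "(\<lambda>(a, g, i) \<omega>.
      (\<lambda>(x, y). (act X (a, g, \<one>\<^bsub>H\<^esub>) x, act Y (\<one>\<^bsub>A\<^esub>, \<one>\<^bsub>H\<^esub>, i) y)) ` \<omega>) = (\<lambda>t. image (\<tau> t))"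
    by (auto simp: \<tau>_def fun_eq_iff)
  have "tensor A G H I X Y = Z"
    unfolding tensor_def Let_def T \<tau>_image trivial Z_def ..
  then show ?thesis
    using Z by (simp add: cls_def \<theta>_def)
qed


section \<open>Elementary bisets\<close>

text \<open>The subgroups that define the elementary bisets all have this form: \<open>D\<close> is \<open>P\<close> or \<open>Q\<close>, and \<open>f\<close>, \<open>g\<close>
  are inclusions, identities or canonical epimorphisms.\<close>

lemma fibered_pair_graph:
  assumes "comm_group A" and "group G" and "group H" and "group D"
    and f: "f \<in> hom D G" and g: "g \<in> hom D H"
  shows "({(f d, g d) | d. d \<in> carrier D}, \<lambda>_. \<one>\<^bsub>A\<^esub>) \<in> fibered_pairs A (G \<times>\<times> H)"
proof -
  interpret A: comm_group A by fact
  have "group_hom D (G \<times>\<times> H) (\<lambda>d. (f d, g d))"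
    using assms by (simp add: group_hom_def group_hom_axioms_def DirProd_group hom_paired)
  then have "subgroup ((\<lambda>d. (f d, g d)) ` carrier D) (G \<times>\<times> H)"
    using group.subgroup_self[OF \<open>group D\<close>] by (rule group_hom.subgroup_img_is_subgroup)
  moreover have "(\<lambda>d. (f d, g d)) ` carrier D = {(f d, g d) | d. d \<in> carrier D}"
    by auto
  ultimately show ?thesis
    by (auto simp: fibered_pairs_def hom_def)
qed

lemma transitive_at_graph:
  assumes "comm_group A" and "group G" and "group H" and "group D"
    and "f \<in> hom D G" and "g \<in> hom D H"
  obtains x where
    "transitive_at A G H (trans_biset A G H {(f d, g d) | d. d \<in> carrier D} (\<lambda>_. \<one>\<^bsub>A\<^esub>)) x
      {(\<one>\<^bsub>A\<^esub>, f d, g d) | d. d \<in> carrier D}"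
proof -
  interpret A: comm_group A by fact
  have tw: "twisted_subgroup A {(f d, g d) | d. d \<in> carrier D} (\<lambda>_. \<one>\<^bsub>A\<^esub>) =
      {(\<one>\<^bsub>A\<^esub>, f d, g d) | d. d \<in> carrier D}"
    by (auto simp: twisted_subgroup_def)
  show thesis
    using transitive_at_trans_biset[OF assms(1-3) fibered_pair_graph[OF assms]]
    unfolding tw by (rule that)
qed

section \<open>Quotients by the kernels of the restrictions\<close>

locale fibered_pair = A: comm_group A + G: group G + H: group H
  for A :: "('a, 'k) monoid_scheme"
    and G :: "('g, 'm) monoid_scheme"
    and H :: "('h, 'n) monoid_scheme" +
  fixes U :: "('g \<times> 'h) set" and \<phi> :: "'g \<times> 'h \<Rightarrow> 'a"
  assumes fibered_pair: "(U, \<phi>) \<in> fibered_pairs A (G \<times>\<times> H)"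
begin

abbreviation GP where "GP \<equiv> G\<lparr>carrier := proj1 U\<rparr>"
abbreviation HQ where "HQ \<equiv> H\<lparr>carrier := proj2 U\<rparr>"

text \<open>\<open>Khat\<close> and \<open>Lhat\<close> are the kernels of the restrictions \<open>\<phi>\<^sub>1\<close> and \<open>\<phi>\<^sub>2\<close>; the inverse in
  the definition of \<open>\<phi>\<^sub>2\<close> does not change its kernel.\<close>

definition Khat where "Khat = {m \<in> carrier G. (m, \<one>\<^bsub>H\<^esub>) \<in> U \<and> \<phi> (m, \<one>\<^bsub>H\<^esub>) = \<one>\<^bsub>A\<^esub>}"
definition Lhat where "Lhat = {n \<in> carrier H. (\<one>\<^bsub>G\<^esub>, n) \<in> U \<and> \<phi> (\<one>\<^bsub>G\<^esub>, n) = \<one>\<^bsub>A\<^esub>}"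

lemma subgroup_U: "subgroup U (G \<times>\<times> H)"
  using fibered_pair by (simp add: fibered_pairs_def)

lemma hom_\<phi>: "\<phi> \<in> hom ((G \<times>\<times> H)\<lparr>carrier := U\<rparr>) A"
  using fibered_pair by (simp add: fibered_pairs_def)

lemma U_carrier: "(p, q) \<in> U \<Longrightarrow> p \<in> carrier G \<and> q \<in> carrier H"
  using subgroup.subset[OF subgroup_U] by auto

lemma U_one: "(\<one>\<^bsub>G\<^esub>, \<one>\<^bsub>H\<^esub>) \<in> U"
  using subgroup.one_closed[OF subgroup_U] by simp

lemma U_mult: "(p, q) \<in> U \<Longrightarrow> (p', q') \<in> U \<Longrightarrow> (p \<otimes>\<^bsub>G\<^esub> p', q \<otimes>\<^bsub>H\<^esub> q') \<in> U"
  using subgroup.m_closed[OF subgroup_U, of "(p, q)" "(p', q')"] by simp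

lemma U_inv: "(p, q) \<in> U \<Longrightarrow> (inv\<^bsub>G\<^esub> p, inv\<^bsub>H\<^esub> q) \<in> U"
  using subgroup.m_inv_closed[OF subgroup_U, of "(p, q)"] U_carrier
  by (simp add: G.is_group H.is_group)

lemma \<phi>_closed: "u \<in> U \<Longrightarrow> \<phi> u \<in> carrier A"
  using hom_\<phi> by (auto simp: hom_def)

lemma \<phi>_mult:
  "(p, q) \<in> U \<Longrightarrow> (p', q') \<in> U \<Longrightarrow> \<phi> (p \<otimes>\<^bsub>G\<^esub> p', q \<otimes>\<^bsub>H\<^esub> q') = \<phi> (p, q) \<otimes>\<^bsub>A\<^esub> \<phi> (p', q')"
  using hom_mult[OF hom_\<phi>, of "(p, q)" "(p', q')"] by simp

lemma \<phi>_one: "\<phi> (\<one>\<^bsub>G\<^esub>, \<one>\<^bsub>H\<^esub>) = \<one>\<^bsub>A\<^esub>"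
  using \<phi>_mult[OF U_one U_one] \<phi>_closed[OF U_one] by (simp add: A.l_cancel_one')

lemma subgroup_proj1: "subgroup (proj1 U) G"
proof (rule G.subgroupI)
  show "proj1 U \<noteq> {}" using U_one by (auto simp: proj1_def)
  show "inv\<^bsub>G\<^esub> p \<in> proj1 U" if "p \<in> proj1 U" for p
    using that U_inv by (force simp: proj1_def)
  show "p \<otimes>\<^bsub>G\<^esub> p' \<in> proj1 U" if "p \<in> proj1 U" "p' \<in> proj1 U" for p p'
    using that U_mult by (force simp: proj1_def)
qed (use U_carrier in \<open>auto simp: proj1_def\<close>)

lemma subgroup_proj2: "subgroup (proj2 U) H"
proof (rule H.subgroupI)
  show "proj2 U \<noteq> {}" using U_one by (auto simp: proj2_def)
  show "inv\<^bsub>H\<^esub> q \<in> proj2 U" if "q \<in> proj2 U" for q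
    using that U_inv by (force simp: proj2_def)
  show "q \<otimes>\<^bsub>H\<^esub> q' \<in> proj2 U" if "q \<in> proj2 U" "q' \<in> proj2 U" for q q'
    using that U_mult by (force simp: proj2_def)
qed (use U_carrier in \<open>auto simp: proj2_def\<close>)

lemma group_GP: "group GP"
  using subgroup.subgroup_is_group[OF subgroup_proj1 G.is_group] .

lemma group_HQ: "group HQ"
  using subgroup.subgroup_is_group[OF subgroup_proj2 H.is_group] .

text \<open>As \<open>A\<close> is commutative, \<open>\<phi>\<close> is invariant under conjugation. This makes \<open>Khat\<close> normal in \<open>P\<close>: a given
  \<open>p \<in> P\<close> has a partner \<open>q\<close> with \<open>(p, q) \<in> U\<close>, and conjugation by \<open>(p, q)\<close> acts on \<open>k\<^sub>1(U) \<times> 1\<close> as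
  conjugation by \<open>p\<close>. The same holds for \<open>Lhat\<close> in \<open>Q\<close>.\<close>

lemma conjugate_U:
  assumes "(p, q) \<in> U" and "(x, y) \<in> U"
  shows "(p \<otimes>\<^bsub>G\<^esub> x \<otimes>\<^bsub>G\<^esub> inv\<^bsub>G\<^esub> p, q \<otimes>\<^bsub>H\<^esub> y \<otimes>\<^bsub>H\<^esub> inv\<^bsub>H\<^esub> q) \<in> U"
    and "\<phi> (p \<otimes>\<^bsub>G\<^esub> x \<otimes>\<^bsub>G\<^esub> inv\<^bsub>G\<^esub> p, q \<otimes>\<^bsub>H\<^esub> y \<otimes>\<^bsub>H\<^esub> inv\<^bsub>H\<^esub> q) = \<phi> (x, y)"
proof -
  note xp = U_mult[OF assms] and pi = U_inv[OF assms(1)]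
  show "(p \<otimes>\<^bsub>G\<^esub> x \<otimes>\<^bsub>G\<^esub> inv\<^bsub>G\<^esub> p, q \<otimes>\<^bsub>H\<^esub> y \<otimes>\<^bsub>H\<^esub> inv\<^bsub>H\<^esub> q) \<in> U"
    using U_mult[OF xp pi] .
  have "\<phi> (p, q) \<otimes>\<^bsub>A\<^esub> \<phi> (inv\<^bsub>G\<^esub> p, inv\<^bsub>H\<^esub> q) = \<one>\<^bsub>A\<^esub>"
    using \<phi>_mult[OF assms(1) pi] U_carrier[OF assms(1)] \<phi>_one by simp
  then have "\<phi> (x, y) = \<phi> (x, y) \<otimes>\<^bsub>A\<^esub> (\<phi> (p, q) \<otimes>\<^bsub>A\<^esub> \<phi> (inv\<^bsub>G\<^esub> p, inv\<^bsub>H\<^esub> q))"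
    using \<phi>_closed[OF assms(2)] by simp
  then show "\<phi> (p \<otimes>\<^bsub>G\<^esub> x \<otimes>\<^bsub>G\<^esub> inv\<^bsub>G\<^esub> p, q \<otimes>\<^bsub>H\<^esub> y \<otimes>\<^bsub>H\<^esub> inv\<^bsub>H\<^esub> q) = \<phi> (x, y)"
    using \<phi>_mult[OF xp pi] \<phi>_mult[OF assms] \<phi>_closed[OF pi] \<phi>_closed[OF assms(1)]
      \<phi>_closed[OF assms(2)]
    by (simp add: A.m_ac)
qed

lemma Khat_absorb:
  assumes "m \<in> Khat" and "(p, q) \<in> U"
  shows "(m \<otimes>\<^bsub>G\<^esub> p, q) \<in> U" and "\<phi> (m \<otimes>\<^bsub>G\<^esub> p, q) = \<phi> (p, q)"
  using assms U_mult[of m "\<one>\<^bsub>H\<^esub>" p q] \<phi>_mult[of m "\<one>\<^bsub>H\<^esub>" p q] U_carrier \<phi>_closed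
  by (auto simp: Khat_def)

lemma Lhat_absorb:
  assumes "n \<in> Lhat" and "(p, q) \<in> U"
  shows "(p, n \<otimes>\<^bsub>H\<^esub> q) \<in> U" and "\<phi> (p, n \<otimes>\<^bsub>H\<^esub> q) = \<phi> (p, q)"
  using assms U_mult[of "\<one>\<^bsub>G\<^esub>" n p q] \<phi>_mult[of "\<one>\<^bsub>G\<^esub>" n p q] U_carrier \<phi>_closed
  by (auto simp: Lhat_def)

lemma normal_Khat: "Khat \<lhd> GP"
proof -
  interpret GP: group GP by (rule group_GP)
  have sub: "Khat \<subseteq> proj1 U"
    by (force simp: Khat_def proj1_def)
  have "subgroup Khat GP"
  proof (rule GP.subgroupI)
    show "Khat \<noteq> {}" using U_one \<phi>_one by (auto simp: Khat_def)
  next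
    fix m assume m: "m \<in> Khat"
    then have mU: "(m, \<one>\<^bsub>H\<^esub>) \<in> U" "m \<in> carrier G" by (auto simp: Khat_def)
    have i: "(inv\<^bsub>G\<^esub> m, \<one>\<^bsub>H\<^esub>) \<in> U"
      using U_inv[OF mU(1)] by simp
    have "\<phi> (inv\<^bsub>G\<^esub> m, \<one>\<^bsub>H\<^esub>) = \<one>\<^bsub>A\<^esub>"
      using Khat_absorb(2)[OF m i] mU \<phi>_one by simp
    then show "inv\<^bsub>GP\<^esub> m \<in> Khat"
      using i mU sub m G.m_inv_consistent[OF subgroup_proj1] by (auto simp: Khat_def)
  next
    fix m m' assume "m \<in> Khat" "m' \<in> Khat"
    then show "m \<otimes>\<^bsub>GP\<^esub> m' \<in> Khat"
      using Khat_absorb[of m m' "\<one>\<^bsub>H\<^esub>"] by (auto simp: Khat_def)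
  qed (use sub in auto)
  moreover have "p \<otimes>\<^bsub>GP\<^esub> m \<otimes>\<^bsub>GP\<^esub> inv\<^bsub>GP\<^esub> p \<in> Khat" if p: "p \<in> carrier GP" and m: "m \<in> Khat" for p m
  proof -
    obtain q where q: "(p, q) \<in> U"
      using p by (auto simp: proj1_def)
    show ?thesis
      using conjugate_U[OF q, of m "\<one>\<^bsub>H\<^esub>"] m U_carrier[OF q] p
        G.m_inv_consistent[OF subgroup_proj1, of p]
      by (simp add: Khat_def)
  qed
  ultimately show ?thesis
    unfolding GP.normal_inv_iff by blast
qed

lemma normal_Lhat: "Lhat \<lhd> HQ"
proof -
  interpret HQ: group HQ by (rule group_HQ)
  have sub: "Lhat \<subseteq> proj2 U"
    by (force simp: Lhat_def proj2_def)
  have "subgroup Lhat HQ"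
  proof (rule HQ.subgroupI)
    show "Lhat \<noteq> {}" using U_one \<phi>_one by (auto simp: Lhat_def)
  next
    fix n assume n: "n \<in> Lhat"
    then have nU: "(\<one>\<^bsub>G\<^esub>, n) \<in> U" "n \<in> carrier H" by (auto simp: Lhat_def)
    have i: "(\<one>\<^bsub>G\<^esub>, inv\<^bsub>H\<^esub> n) \<in> U"
      using U_inv[OF nU(1)] by simp
    have "\<phi> (\<one>\<^bsub>G\<^esub>, inv\<^bsub>H\<^esub> n) = \<one>\<^bsub>A\<^esub>"
      using Lhat_absorb(2)[OF n i] nU \<phi>_one by simp
    then show "inv\<^bsub>HQ\<^esub> n \<in> Lhat"
      using i nU sub n H.m_inv_consistent[OF subgroup_proj2] by (auto simp: Lhat_def)
  next
    fix n n' assume "n \<in> Lhat" "n' \<in> Lhat"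
    then show "n \<otimes>\<^bsub>HQ\<^esub> n' \<in> Lhat"
      using Lhat_absorb[of n "\<one>\<^bsub>G\<^esub>" n'] by (auto simp: Lhat_def)
  qed (use sub in auto)
  moreover have "q \<otimes>\<^bsub>HQ\<^esub> n \<otimes>\<^bsub>HQ\<^esub> inv\<^bsub>HQ\<^esub> q \<in> Lhat" if q: "q \<in> carrier HQ" and n: "n \<in> Lhat" for q n
  proof -
    obtain p where p: "(p, q) \<in> U"
      using q by (auto simp: proj2_def)
    show ?thesis
      using conjugate_U[OF p, of "\<one>\<^bsub>G\<^esub>" n] n U_carrier[OF p] q
        H.m_inv_consistent[OF subgroup_proj2, of q]
      by (simp add: Lhat_def)
  qed
  ultimately show ?thesis
    unfolding HQ.normal_inv_iff by blast
qed

abbreviation \<pi>K where "\<pi>K p \<equiv> Khat #>\<^bsub>G\<^esub> p"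
abbreviation \<pi>L where "\<pi>L q \<equiv> Lhat #>\<^bsub>H\<^esub> q"

text \<open>Membership in \<open>U\<close> and the value of \<open>\<phi>\<close> depend only on the cosets of the coordinates. This is what allows
  inflation and deflation to undo the passage to the quotient.\<close>

lemma \<pi>K_eqD:
  assumes "\<pi>K p = \<pi>K p'" and "p \<in> proj1 U" and U: "(p', q) \<in> U"
  shows "(p, q) \<in> U" and "\<phi> (p, q) = \<phi> (p', q)"
proof -
  have "p \<in> \<pi>K p'"
    using group.rcos_self[OF group_GP, of p Khat] normal_imp_subgroup[OF normal_Khat] assms by simp
  then obtain m where "m \<in> Khat" "p = m \<otimes>\<^bsub>G\<^esub> p'"
    by (auto simp: r_coset_def)
  then show "(p, q) \<in> U" "\<phi> (p, q) = \<phi> (p', q)"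
    using Khat_absorb U by simp_all
qed

lemma \<pi>L_eqD:
  assumes "\<pi>L q = \<pi>L q'" and "q \<in> proj2 U" and U: "(p, q') \<in> U"
  shows "(p, q) \<in> U" and "\<phi> (p, q) = \<phi> (p, q')"
proof -
  have "q \<in> \<pi>L q'"
    using group.rcos_self[OF group_HQ, of q Lhat] normal_imp_subgroup[OF normal_Lhat] assms by simp
  then obtain n where "n \<in> Lhat" "q = n \<otimes>\<^bsub>H\<^esub> q'"
    by (auto simp: r_coset_def)
  then show "(p, q) \<in> U" "\<phi> (p, q) = \<phi> (p, q')"
    using Lhat_absorb U by simp_all
qed

lemma coset_times: "\<pi>K p \<times> \<pi>L q = (Khat \<times> Lhat) #>\<^bsub>GP \<times>\<times> HQ\<^esub> (p, q)"
  by (auto simp: r_coset_def)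

lemma coset_nonempty: "p \<in> proj1 U \<Longrightarrow> \<pi>K p \<noteq> {}" "q \<in> proj2 U \<Longrightarrow> \<pi>L q \<noteq> {}"
  using U_one \<phi>_one by (auto simp: r_coset_def Khat_def Lhat_def)

lemma quot_subgroup_eq: "quot_subgroup GP HQ U Khat Lhat = {(\<pi>K p, \<pi>L q) | p q. (p, q) \<in> U}"
proof (intro equalityI subsetI)
  fix z assume "z \<in> quot_subgroup GP HQ U Khat Lhat"
  then obtain p q p' q' where z: "z = (\<pi>K p, \<pi>L q)" and pq: "p \<in> proj1 U" "q \<in> proj2 U"
    and U: "(p', q') \<in> U" and eq: "\<pi>K p \<times> \<pi>L q = \<pi>K p' \<times> \<pi>L q'"
    by (auto simp: quot_subgroup_def carrier_FactGroup simp flip: coset_times)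
  have "\<pi>K p = \<pi>K p'" "\<pi>L q = \<pi>L q'"
    using eq coset_nonempty pq by (auto simp only: times_eq_iff)
  then show "z \<in> {(\<pi>K p, \<pi>L q) | p q. (p, q) \<in> U}"
    using z U by blast
next
  fix z assume "z \<in> {(\<pi>K p, \<pi>L q) | p q. (p, q) \<in> U}"
  then obtain p q where z: "z = (\<pi>K p, \<pi>L q)" and U: "(p, q) \<in> U" by blast
  have "p \<in> proj1 U" "q \<in> proj2 U"
    using U by (force simp: proj1_def proj2_def)+
  then show "z \<in> quot_subgroup GP HQ U Khat Lhat"
    using U by (auto simp: z quot_subgroup_def carrier_FactGroup coset_times)
qed

lemma quot_hom_eq:
  assumes U: "(p, q) \<in> U"
  shows "quot_hom \<phi> (\<pi>K p, \<pi>L q) = \<phi> (p, q)"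
proof -
  have "\<phi> u = \<phi> (p, q)" if "u \<in> \<pi>K p \<times> \<pi>L q" for u
    using that U Lhat_absorb Khat_absorb by (auto simp: r_coset_def)
  moreover have "\<pi>K p \<times> \<pi>L q \<noteq> {}"
    using coset_nonempty(1)[of p] coset_nonempty(2)[of q] U by (force simp: proj1_def proj2_def)
  ultimately have "\<phi> ` (\<pi>K p \<times> \<pi>L q) = {\<phi> (p, q)}"
    by (metis image_constant_conv image_cong)
  then show ?thesis
    by (simp add: quot_hom_def)
qed

lemma fibered_pair_quot:
  "(quot_subgroup GP HQ U Khat Lhat, quot_hom \<phi>) \<in> fibered_pairs A ((GP Mod Khat) \<times>\<times> (HQ Mod Lhat))"
proof -
  interpret GP: group GP by (rule group_GP)
  interpret HQ: group HQ by (rule group_HQ)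
  interpret Khat: normal Khat GP by (rule normal_Khat)
  interpret Lhat: normal Lhat HQ by (rule normal_Lhat)
  let ?quot = "(GP Mod Khat) \<times>\<times> (HQ Mod Lhat)" and ?\<pi> = "\<lambda>(p, q). (\<pi>K p, \<pi>L q)"
  have \<pi>K: "\<pi>K \<in> hom GP (GP Mod Khat)" and \<pi>L: "\<pi>L \<in> hom HQ (HQ Mod Lhat)"
    using Khat.r_coset_hom_Mod Lhat.r_coset_hom_Mod by simp_all
  have "group_hom ((G \<times>\<times> H)\<lparr>carrier := U\<rparr>) ?quot ?\<pi>"
  proof -
    have "?\<pi> \<in> hom ((G \<times>\<times> H)\<lparr>carrier := U\<rparr>) ?quot"
    proof (rule homI)
      fix u v assume "u \<in> carrier ((G \<times>\<times> H)\<lparr>carrier := U\<rparr>)" "v \<in> carrier ((G \<times>\<times> H)\<lparr>carrier := U\<rparr>)"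
      then obtain p q p' q' where uv: "u = (p, q)" "v = (p', q')"
        and U: "p \<in> proj1 U" "p' \<in> proj1 U" "q \<in> proj2 U" "q' \<in> proj2 U"
        by (cases u, cases v) (force simp: proj1_def proj2_def)
      show "?\<pi> (u \<otimes>\<^bsub>(G \<times>\<times> H)\<lparr>carrier := U\<rparr>\<^esub> v) = ?\<pi> u \<otimes>\<^bsub>?quot\<^esub> ?\<pi> v"
        using hom_mult[OF \<pi>K, of p p'] hom_mult[OF \<pi>L, of q q'] U by (simp add: uv)
    next
      fix u assume "u \<in> carrier ((G \<times>\<times> H)\<lparr>carrier := U\<rparr>)"
      then obtain p q where u: "u = (p, q)" and U: "p \<in> proj1 U" "q \<in> proj2 U"
        by (cases u) (force simp: proj1_def proj2_def)
      show "?\<pi> u \<in> carrier ?quot"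
        using hom_in_carrier[OF \<pi>K, of p] hom_in_carrier[OF \<pi>L, of q] U by (simp add: u)
    qed
    then show ?thesis
      using subgroup.subgroup_is_group[OF subgroup_U] G.is_group H.is_group
        Khat.factorgroup_is_group Lhat.factorgroup_is_group
      by (simp add: group_hom_def group_hom_axioms_def DirProd_group)
  qed
  then interpret \<pi>: group_hom "(G \<times>\<times> H)\<lparr>carrier := U\<rparr>" ?quot ?\<pi> .
  have image: "quot_subgroup GP HQ U Khat Lhat = ?\<pi> ` U"
    unfolding quot_subgroup_eq by force
  have "subgroup (quot_subgroup GP HQ U Khat Lhat) ?quot"
    using \<pi>.img_is_subgroup by (simp add: image)
  moreover have "quot_hom \<phi> \<in> hom (?quot\<lparr>carrier := quot_subgroup GP HQ U Khat Lhat\<rparr>) A"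
  proof (rule homI)
    fix z w
    assume "z \<in> carrier (?quot\<lparr>carrier := quot_subgroup GP HQ U Khat Lhat\<rparr>)"
      and "w \<in> carrier (?quot\<lparr>carrier := quot_subgroup GP HQ U Khat Lhat\<rparr>)"
    then obtain p q p' q' where U: "(p, q) \<in> U" "(p', q') \<in> U"
      and zw: "z = ?\<pi> (p, q)" "w = ?\<pi> (p', q')"
      by (auto simp: image)
    have "z \<otimes>\<^bsub>?quot\<^esub> w = ?\<pi> (p \<otimes>\<^bsub>G\<^esub> p', q \<otimes>\<^bsub>H\<^esub> q')"
      using \<pi>.hom_mult[of "(p, q)" "(p', q')"] U by (simp add: zw)
    then show "quot_hom \<phi> (z \<otimes>\<^bsub>?quot\<lparr>carrier := quot_subgroup GP HQ U Khat Lhat\<rparr>\<^esub> w) =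
        quot_hom \<phi> z \<otimes>\<^bsub>A\<^esub> quot_hom \<phi> w"
      using U by (simp add: zw quot_hom_eq U_mult \<phi>_mult)
  next
    fix z assume "z \<in> carrier (?quot\<lparr>carrier := quot_subgroup GP HQ U Khat Lhat\<rparr>)"
    then obtain p q where "(p, q) \<in> U" "z = ?\<pi> (p, q)"
      by (auto simp: image)
    then show "quot_hom \<phi> z \<in> carrier A"
      by (simp add: quot_hom_eq \<phi>_closed)
  qed
  ultimately show ?thesis
    by (simp add: fibered_pairs_def)
qed


section \<open>Composition of the five stabilizers\<close>

lemma decomposition:
  assumes "finite (carrier G)" and "finite (carrier H)"
  shows "biset_iso A G H
    (trans_biset A G H U \<phi>)
    (tensor A G HQ H
      (tensor A G (HQ Mod Lhat) HQ
        (tensor A G (GP Mod Khat) (HQ Mod Lhat)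
          (tensor A G GP (GP Mod Khat) (Ind_biset A G (proj1 U)) (Inf_biset A GP Khat))
          (trans_biset A (GP Mod Khat) (HQ Mod Lhat) (quot_subgroup GP HQ U Khat Lhat) (quot_hom \<phi>)))
        (Def_biset A HQ Lhat))
      (Res_biset A H (proj2 U)))"
proof -
  let ?PK = "GP Mod Khat" and ?QL = "HQ Mod Lhat" and ?S = "twisted_subgroup A U \<phi>"
  note A = A.comm_group_axioms and groups = G.is_group H.is_group group_GP group_HQ
    normal.factorgroup_is_group[OF normal_Khat] normal.factorgroup_is_group[OF normal_Lhat]
  have incl_P: "(\<lambda>p. p) \<in> hom GP G" and incl_Q: "(\<lambda>q. q) \<in> hom HQ H"
    and id_P: "(\<lambda>p. p) \<in> hom GP GP" and id_Q: "(\<lambda>q. q) \<in> hom HQ HQ"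
    using subgroup.subset[OF subgroup_proj1] subgroup.subset[OF subgroup_proj2]
    by (auto simp: hom_def)
  have \<pi>K: "\<pi>K \<in> hom GP ?PK" and \<pi>L: "\<pi>L \<in> hom HQ ?QL"
    using normal.r_coset_hom_Mod[OF normal_Khat] normal.r_coset_hom_Mod[OF normal_Lhat] by simp_all
  have proj: "p \<in> proj1 U" "q \<in> proj2 U" if "(p, q) \<in> U" for p q
    using that by (force simp: proj1_def proj2_def)+
  have inv_\<phi>: "inv\<^bsub>A\<^esub> \<phi> u \<in> carrier A" if "u \<in> U" for u
    using \<phi>_closed[OF that] by simp
  have S: "?S = {(inv\<^bsub>A\<^esub> \<phi> (p, q), p, q) | p q. (p, q) \<in> U}"
    by (auto simp: twisted_subgroup_def)

  obtain x1 where ind: "transitive_at A G GP (Ind_biset A G (proj1 U)) x1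
      {(\<one>\<^bsub>A\<^esub>, p, p) | p. p \<in> proj1 U}"
    using transitive_at_graph[OF A groups(1,3,3) incl_P id_P] by (auto simp: Ind_biset_def)
  obtain x2 where inf: "transitive_at A GP ?PK (Inf_biset A GP Khat) x2
      {(\<one>\<^bsub>A\<^esub>, p, \<pi>K p) | p. p \<in> proj1 U}"
    using transitive_at_graph[OF A groups(3,5,3) id_P \<pi>K] by (auto simp: Inf_biset_def)
  obtain x3 where quot: "transitive_at A ?PK ?QL
      (trans_biset A ?PK ?QL (quot_subgroup GP HQ U Khat Lhat) (quot_hom \<phi>)) x3
      {(inv\<^bsub>A\<^esub> \<phi> (p, q), \<pi>K p, \<pi>L q) | p q. (p, q) \<in> U}"
  proof -
    have tw: "twisted_subgroup A (quot_subgroup GP HQ U Khat Lhat) (quot_hom \<phi>) =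
        {(inv\<^bsub>A\<^esub> \<phi> (p, q), \<pi>K p, \<pi>L q) | p q. (p, q) \<in> U}"
      by (force simp: twisted_subgroup_def quot_subgroup_eq quot_hom_eq)
    show thesis
      using transitive_at_trans_biset[OF A groups(5,6) fibered_pair_quot] unfolding tw by (rule that)
  qed
  obtain x4 where deflation: "transitive_at A ?QL HQ (Def_biset A HQ Lhat) x4
      {(\<one>\<^bsub>A\<^esub>, \<pi>L q, q) | q. q \<in> proj2 U}"
    using transitive_at_graph[OF A groups(6,4,4) \<pi>L id_Q] by (auto simp: Def_biset_def)
  obtain x5 where res: "transitive_at A HQ H (Res_biset A H (proj2 U)) x5
      {(\<one>\<^bsub>A\<^esub>, q, q) | q. q \<in> proj2 U}"
    using transitive_at_graph[OF A groups(4,2,4) id_Q incl_Q] by (auto simp: Res_biset_def)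

  have comp1: "stabilizer_comp A {(\<one>\<^bsub>A\<^esub>, p, p) | p. p \<in> proj1 U}
      {(\<one>\<^bsub>A\<^esub>, p, \<pi>K p) | p. p \<in> proj1 U} = {(\<one>\<^bsub>A\<^esub>, p, \<pi>K p) | p. p \<in> proj1 U}"
    by (auto simp: stabilizer_comp_def)
  have comp2: "stabilizer_comp A {(\<one>\<^bsub>A\<^esub>, p, \<pi>K p) | p. p \<in> proj1 U}
      {(inv\<^bsub>A\<^esub> \<phi> (p, q), \<pi>K p, \<pi>L q) | p q. (p, q) \<in> U} =
      {(inv\<^bsub>A\<^esub> \<phi> (p, q), p, \<pi>L q) | p q. (p, q) \<in> U}" (is "stabilizer_comp A ?L ?R = ?C")
  proof (intro equalityI subsetI)
    fix t assume "t \<in> stabilizer_comp A ?L ?R"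
    then obtain p p' q where t: "t = (\<one>\<^bsub>A\<^esub> \<otimes>\<^bsub>A\<^esub> inv\<^bsub>A\<^esub> \<phi> (p', q), p, \<pi>L q)"
      and p: "p \<in> proj1 U" "\<pi>K p = \<pi>K p'" and U: "(p', q) \<in> U"
      by (auto simp: stabilizer_comp_def)
    have "t = (inv\<^bsub>A\<^esub> \<phi> (p, q), p, \<pi>L q)"
      using \<pi>K_eqD(2)[OF p(2,1) U] inv_\<phi>[OF U] by (simp add: t)
    then show "t \<in> ?C"
      using \<pi>K_eqD(1)[OF p(2,1) U] by blast
  next
    fix t assume "t \<in> ?C"
    then obtain p q where "t = (inv\<^bsub>A\<^esub> \<phi> (p, q), p, \<pi>L q)" "(p, q) \<in> U" by blast
    moreover from this have "inv\<^bsub>A\<^esub> \<phi> (p, q) = \<one>\<^bsub>A\<^esub> \<otimes>\<^bsub>A\<^esub> inv\<^bsub>A\<^esub> \<phi> (p, q)"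
      using inv_\<phi> by simp
    ultimately show "t \<in> stabilizer_comp A ?L ?R"
      using proj unfolding stabilizer_comp_def by blast
  qed
  have comp3: "stabilizer_comp A {(inv\<^bsub>A\<^esub> \<phi> (p, q), p, \<pi>L q) | p q. (p, q) \<in> U}
      {(\<one>\<^bsub>A\<^esub>, \<pi>L q, q) | q. q \<in> proj2 U} = ?S" (is "stabilizer_comp A ?L ?R = _")
  proof (intro equalityI subsetI)
    fix t assume "t \<in> stabilizer_comp A ?L ?R"
    then obtain p q q' where t: "t = (inv\<^bsub>A\<^esub> \<phi> (p, q') \<otimes>\<^bsub>A\<^esub> \<one>\<^bsub>A\<^esub>, p, q)"
      and q: "q \<in> proj2 U" "\<pi>L q = \<pi>L q'" and U: "(p, q') \<in> U"
      by (auto simp: stabilizer_comp_def)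
    show "t \<in> ?S"
      using \<pi>L_eqD[OF q(2,1) U] inv_\<phi>[OF U] unfolding t S by auto
  next
    fix t assume "t \<in> ?S"
    then obtain p q where "t = (inv\<^bsub>A\<^esub> \<phi> (p, q), p, q)" "(p, q) \<in> U" unfolding S by blast
    moreover from this have "inv\<^bsub>A\<^esub> \<phi> (p, q) = inv\<^bsub>A\<^esub> \<phi> (p, q) \<otimes>\<^bsub>A\<^esub> \<one>\<^bsub>A\<^esub>"
      using inv_\<phi> by simp
    ultimately show "t \<in> stabilizer_comp A ?L ?R"
      using proj unfolding stabilizer_comp_def by blast
  qed
  have comp4: "stabilizer_comp A ?S {(\<one>\<^bsub>A\<^esub>, q, q) | q. q \<in> proj2 U} = ?S"
    (is "stabilizer_comp A _ ?R = _")
  proof (intro equalityI subsetI)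
    fix t assume "t \<in> stabilizer_comp A ?S ?R"
    then obtain p q where "t = (inv\<^bsub>A\<^esub> \<phi> (p, q) \<otimes>\<^bsub>A\<^esub> \<one>\<^bsub>A\<^esub>, p, q)" "(p, q) \<in> U"
      by (auto simp: stabilizer_comp_def S)
    then show "t \<in> ?S"
      using inv_\<phi> by (auto simp: S)
  next
    fix t assume "t \<in> ?S"
    then obtain p q where "t = (inv\<^bsub>A\<^esub> \<phi> (p, q), p, q)" "(p, q) \<in> U" unfolding S by blast
    moreover from this have "inv\<^bsub>A\<^esub> \<phi> (p, q) = inv\<^bsub>A\<^esub> \<phi> (p, q) \<otimes>\<^bsub>A\<^esub> \<one>\<^bsub>A\<^esub>"
      using inv_\<phi> by simp
    ultimately show "t \<in> stabilizer_comp A ?S ?R"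
      using proj unfolding stabilizer_comp_def S by blast
  qed
  have free: "a = \<one>\<^bsub>A\<^esub>" if "(a, \<one>\<^bsub>G\<^esub>, \<one>\<^bsub>H\<^esub>) \<in> ?S" for a
    using that by (simp add: mem_twisted_subgroup_iff \<phi>_one)

  obtain y1 where y1: "transitive_at A G ?PK
      (tensor A G GP ?PK (Ind_biset A G (proj1 U)) (Inf_biset A GP Khat)) y1
      {(\<one>\<^bsub>A\<^esub>, p, \<pi>K p) | p. p \<in> proj1 U}"
  proof (rule that, rule transitive_at_tensor[OF A groups(1,3,5) ind inf, unfolded comp1])
    show "\<exists>a g. (a, g, h) \<in> {(\<one>\<^bsub>A\<^esub>, p, p) | p. p \<in> proj1 U}" if "h \<in> carrier GP" for h
      using that by simp
  qed blast
  obtain y2 where y2: "transitive_at A G ?QL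
      (tensor A G ?PK ?QL
        (tensor A G GP ?PK (Ind_biset A G (proj1 U)) (Inf_biset A GP Khat))
        (trans_biset A ?PK ?QL (quot_subgroup GP HQ U Khat Lhat) (quot_hom \<phi>))) y2
      {(inv\<^bsub>A\<^esub> \<phi> (p, q), p, \<pi>L q) | p q. (p, q) \<in> U}"
  proof (rule that, rule transitive_at_tensor[OF A groups(1,5,6) y1 quot, unfolded comp2])
    show "\<exists>a g. (a, g, h) \<in> {(\<one>\<^bsub>A\<^esub>, p, \<pi>K p) | p. p \<in> proj1 U}" if "h \<in> carrier ?PK" for h
      using that by (auto simp: carrier_FactGroup)
    show "a = \<one>\<^bsub>A\<^esub>"
      if a: "(a, \<one>\<^bsub>G\<^esub>, \<one>\<^bsub>?QL\<^esub>) \<in> {(inv\<^bsub>A\<^esub> \<phi> (p, q), p, \<pi>L q) | p q. (p, q) \<in> U}" for a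
    proof -
      obtain q where q: "(\<one>\<^bsub>G\<^esub>, q) \<in> U" "\<pi>L q = Lhat" and a: "a = inv\<^bsub>A\<^esub> \<phi> (\<one>\<^bsub>G\<^esub>, q)"
        using a by auto
      \<comment> \<open>The unit of \<open>Q / Lhat\<close> is \<open>Lhat\<close>, so \<open>q\<close> lies in the kernel of \<open>\<phi>\<^sub>2\<close>.\<close>
      have "\<pi>L \<one>\<^bsub>H\<^esub> = \<pi>L q"
        using group.coset_mult_one[OF group_HQ, of Lhat] normal_imp_subgroup[OF normal_Lhat] q(2)
        by (simp add: subgroup_def)
      then have "\<phi> (\<one>\<^bsub>G\<^esub>, q) = \<one>\<^bsub>A\<^esub>"
        using \<pi>L_eqD(2)[OF _ proj(2)[OF U_one] q(1)] \<phi>_one by simp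
      then show ?thesis
        by (simp add: a)
    qed
  qed
  obtain y3 where y3: "transitive_at A G HQ
      (tensor A G ?QL HQ
        (tensor A G ?PK ?QL
          (tensor A G GP ?PK (Ind_biset A G (proj1 U)) (Inf_biset A GP Khat))
          (trans_biset A ?PK ?QL (quot_subgroup GP HQ U Khat Lhat) (quot_hom \<phi>)))
        (Def_biset A HQ Lhat)) y3 ?S"
  proof (rule that, rule transitive_at_tensor[OF A groups(1,6,4) y2 deflation, unfolded comp3])
    show "\<exists>a g. (a, g, h) \<in> {(inv\<^bsub>A\<^esub> \<phi> (p, q), p, \<pi>L q) | p q. (p, q) \<in> U}"
      if h: "h \<in> carrier ?QL" for h
    proof -
      obtain p q where "(p, q) \<in> U" "h = \<pi>L q"
        using h by (auto simp: carrier_FactGroup proj2_def)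
      then show ?thesis by blast
    qed
  qed (simp add: free)
  obtain y4 where y4: "transitive_at A G H
      (tensor A G HQ H
        (tensor A G ?QL HQ
          (tensor A G ?PK ?QL
            (tensor A G GP ?PK (Ind_biset A G (proj1 U)) (Inf_biset A GP Khat))
            (trans_biset A ?PK ?QL (quot_subgroup GP HQ U Khat Lhat) (quot_hom \<phi>)))
          (Def_biset A HQ Lhat))
        (Res_biset A H (proj2 U))) y4 ?S"
  proof (rule that, rule transitive_at_tensor[OF A groups(1,4,2) y3 res, unfolded comp4])
    show "\<exists>a g. (a, g, h) \<in> ?S" if "h \<in> carrier HQ" for h
      using that by (auto simp: S proj2_def)
  qed (rule free)
  show ?thesis
    using biset_iso_if_equal_stabilizers[OF A groups(1) assms(1) groups(2) assms(2)
        transitive_at_trans_biset[OF A groups(1,2) fibered_pair] y4 free] .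
qed

end

theorem proposition2p8:
  fixes A :: "('a, 'k) monoid_scheme"
    and G :: "('g, 'm) monoid_scheme"
    and H :: "('h, 'n) monoid_scheme"
    and U :: "('g \<times> 'h) set"
    and \<phi> :: "'g \<times> 'h \<Rightarrow> 'a"
  assumes "comm_group A"
    and "group G" and "finite (carrier G)"
    and "group H" and "finite (carrier H)"
    and "(U, \<phi>) \<in> fibered_pairs A (G \<times>\<times> H)"
    and "P = proj1 U" and "K = ker1 G H U" and "\<kappa> = restr1 H \<phi>"
    and "Q = proj2 U" and "L = ker2 G H U" and "lam = restr2 A G \<phi>"
    and "K' = kernel (G\<lparr>carrier := K\<rparr>) A \<kappa>"
    and "L' = kernel (H\<lparr>carrier := L\<rparr>) A lam"
    and "GP = G\<lparr>carrier := P\<rparr>" and "HQ = H\<lparr>carrier := Q\<rparr>"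
    and "X = trans_biset A (GP Mod K') (HQ Mod L') (quot_subgroup GP HQ U K' L') (quot_hom \<phi>)"
  shows "biset_iso A G H
    (trans_biset A G H U \<phi>)
    (tensor A G HQ H
      (tensor A G (HQ Mod L') HQ
        (tensor A G (GP Mod K') (HQ Mod L')
          (tensor A G GP (GP Mod K') (Ind_biset A G P) (Inf_biset A GP K'))
          X)
        (Def_biset A HQ L'))
      (Res_biset A H Q))"
proof -
  interpret fibered_pair A G H U \<phi>
    using assms(1,2,4,6) by (simp add: fibered_pair_def fibered_pair_axioms_def)
  have "K' = Khat"
    by (auto simp: assms(8,9,13) Khat_def kernel_def ker1_def restr1_def)
  moreover have "L' = Lhat"
    using \<phi>_closed by (auto simp: assms(11,12,14) Lhat_def kernel_def ker2_def restr2_def)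
  ultimately show ?thesis
    using decomposition[OF assms(3,5)] by (simp only: assms(7,10,15,16,17))
qed

end
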